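(* Let $f:\mathbb{R}^n\to\mathbb{R}$ and $g_i:\mathbb{R}^n\to\mathbb{R}$, $i=1,\dots,m$, be convex and continuously differentiable, let $h(x)=Ax-b$ with $A\in\mathbb{R}^{p\times n}$, $b\in\mathbb{R}^p$, and suppose there exists $\bar x$ with $A\bar x=b$ and $g(\bar x)<0$ (Slater's condition). Assume that the program $\min f(x)$ s.t. $Ax=b$, $g(x)\le 0$ admits at least one optimal solution. Consider the SPPID dynamics (defined in the context). Then, for every $k_d^{eq}\ge 0$ and $k_p^{eq},k_i^{eq},k_p^{in},k_i^{in}>0$: (i) every trajectory converges to the set $\mathcal{K}$ of KKT points of the program; (ii) if additionally $f$ is strictly convex and LICQ holds at the minimizer $x^\star$, then the program has a unique KKT point $z^\star:=(x^\star,\nu^\star,\xi^\star)$, and $z^\star$ is globally asymptotically stable.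
   Context: $\mathrm{ReLU}(y)=\max(y,0)$ componentwise; vector inequalities are entrywise; $g=(g_1,\dots,g_m)$ and $J_g$ is its Jacobian. With $M:=I_n+k_d^{eq}A^\top A$, the SPPID dynamics with state $(x,\nu,\xi)\in\mathbb{R}^n\times\mathbb{R}^p\times\mathbb{R}^m$ are $$\dot x=-M^{-1}\Big(\nabla f(x)+A^\top\big(\nu+k_p^{eq}(Ax-b)\big)+J_g(x)^\top\mathrm{ReLU}(\xi+k_p^{in}g(x))\Big),$$ $$\dot\nu=k_i^{eq}(Ax-b),\qquad \dot\xi=-k_i^{in}\xi+k_i^{in}\mathrm{ReLU}(\xi+k_p^{in}g(x)).$$ A point $(x^\star,\nu^\star,\xi^\star)$ is a KKT point if $\nabla f(x^\star)+A^\top\nu^\star+J_g(x^\star)^\top\xi^\star=0$, $Ax^\star=b$, $g(x^\star)\le0$, $\xi^\star\ge0$, and $\xi^\star_ig_i(x^\star)=0$ for all $i$; $\mathcal{K}$ is the set of KKT points. Convergence of a trajectory $z(t)$ to $\mathcal{K}$ means $\mathrm{dist}(z(t),\mathcal{K})\to0$ as $t\to\infty$. LICQ at a feasible $x$: the gradients of all equality constraints (the rows of $A$) and $\nabla g_i(x)$, $i\in\mathcal{A}(x):=\{i: g_i(x)=0\}$, are linearly independent. *)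

theory Defs
  imports "HOL-Analysis.Analysis"
begin

definition gradient :: "(real^'n \<Rightarrow> real) \<Rightarrow> real^'n \<Rightarrow> real^'n" where
  "gradient f x = (THE d. GDERIV f x :> d)"

definition continuously_differentiable :: "(real^'n \<Rightarrow> real) \<Rightarrow> bool" where
  "continuously_differentiable f \<longleftrightarrow>
     (\<forall>x. f differentiable (at x)) \<and> continuous_on UNIV (gradient f)"

definition strictly_convex :: "(real^'n \<Rightarrow> real) \<Rightarrow> bool" where
  "strictly_convex f \<longleftrightarrow>
     (\<forall>x y. \<forall>t\<in>{0<..<1}. x \<noteq> y \<longrightarrow>
        f ((1 - t) *\<^sub>R x + t *\<^sub>R y) < (1 - t) * f x + t * f y)"

text \<open>
  The order on vectors is the componentwise one, so \<open>g x \<le> 0\<close> and \<open>0 \<le> \<xi>\<close> are entrywise.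
  (The strict order on vectors is not entrywise and is therefore never used.)
\<close>

definition feasible ::
  "(real^'n \<Rightarrow> real^'m) \<Rightarrow> real^'n^'p \<Rightarrow> real^'p \<Rightarrow> real^'n \<Rightarrow> bool" where
  "feasible g A b x \<longleftrightarrow> A *v x = b \<and> g x \<le> 0"

definition slater ::
  "(real^'n \<Rightarrow> real^'m) \<Rightarrow> real^'n^'p \<Rightarrow> real^'p \<Rightarrow> bool" where
  "slater g A b \<longleftrightarrow> (\<exists>x. A *v x = b \<and> (\<forall>i. g x $ i < 0))"

definition optimal ::
  "(real^'n \<Rightarrow> real) \<Rightarrow> (real^'n \<Rightarrow> real^'m) \<Rightarrow> real^'n^'p \<Rightarrow> real^'p \<Rightarrow> real^'n \<Rightarrow> bool" where
  "optimal f g A b x \<longleftrightarrow> is_arg_min f (feasible g A b) x"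

definition KKT_points ::
  "(real^'n \<Rightarrow> real) \<Rightarrow> (real^'n \<Rightarrow> real^'m) \<Rightarrow> real^'n^'p \<Rightarrow> real^'p \<Rightarrow>
   ((real^'n) \<times> (real^'p) \<times> (real^'m)) set" where
  "KKT_points f g A b =
     {(x, \<nu>, \<xi>).
        gradient f x + transpose A *v \<nu> + transpose (jacobian g (at x)) *v \<xi> = 0 \<and>
        A *v x = b \<and> g x \<le> 0 \<and> 0 \<le> \<xi> \<and> (\<forall>i. \<xi> $ i * g x $ i = 0)}"

text \<open>
  The constraint gradients are a family indexed by the disjoint sum of the two index types;
  injectivity is needed because \<open>independent\<close> is a property of sets and would ignore repetitions.
\<close>

definition constraint_gradient ::
  "(real^'n \<Rightarrow> real^'m) \<Rightarrow> real^'n^'p \<Rightarrow> real^'n \<Rightarrow> 'p + 'm \<Rightarrow> real^'n" where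
  "constraint_gradient g A x =
     case_sum (\<lambda>j. row j A) (\<lambda>i. gradient (\<lambda>y. g y $ i) x)"

definition LICQ :: "(real^'n \<Rightarrow> real^'m) \<Rightarrow> real^'n^'p \<Rightarrow> real^'n \<Rightarrow> bool" where
  "LICQ g A x \<longleftrightarrow>
     (let I = UNIV <+> {i. g x $ i = 0}; v = constraint_gradient g A x
      in inj_on v I \<and> independent (v ` I))"

definition ReLU :: "real^'m \<Rightarrow> real^'m" where
  "ReLU y = (\<chi> i. max (y $ i) 0)"

definition sppid_field ::
  "(real^'n \<Rightarrow> real) \<Rightarrow> (real^'n \<Rightarrow> real^'m) \<Rightarrow> real^'n^'p \<Rightarrow> real^'p \<Rightarrow>
   real \<Rightarrow> real \<Rightarrow> real \<Rightarrow> real \<Rightarrow> real \<Rightarrow>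
   (real^'n) \<times> (real^'p) \<times> (real^'m) \<Rightarrow> (real^'n) \<times> (real^'p) \<times> (real^'m)" where
  "sppid_field f g A b kd_eq kp_eq ki_eq kp_in ki_in = (\<lambda>(x, \<nu>, \<xi>).
     let M = mat 1 + kd_eq *\<^sub>R (transpose A ** A);
         r = ReLU (\<xi> + kp_in *\<^sub>R g x)
     in (- (matrix_inv M *v
            (gradient f x + transpose A *v (\<nu> + kp_eq *\<^sub>R (A *v x - b))
             + transpose (jacobian g (at x)) *v r)),
         ki_eq *\<^sub>R (A *v x - b),
         - ki_in *\<^sub>R \<xi> + ki_in *\<^sub>R r))"

text \<open>
  The vector field is continuous but in general not locally Lipschitz, so solutions need not be
  unique. A trajectory is a maximal forward solution, on \<open>[0,T)\<close> with \<open>0 < T \<le> \<infinity>\<close>;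
  completeness (\<open>T = \<infinity>\<close>) is part of every convergence claim rather than an assumption.
\<close>

definition solution_upto ::
  "('a::real_normed_vector \<Rightarrow> 'a) \<Rightarrow> ereal \<Rightarrow> (real \<Rightarrow> 'a) \<Rightarrow> bool" where
  "solution_upto F T z \<longleftrightarrow> 0 < T \<and>
     (\<forall>t\<ge>0. ereal t < T \<longrightarrow> (z has_vector_derivative F (z t)) (at t within {0..}))"

definition trajectory ::
  "('a::real_normed_vector \<Rightarrow> 'a) \<Rightarrow> ereal \<Rightarrow> (real \<Rightarrow> 'a) \<Rightarrow> bool" where
  "trajectory F T z \<longleftrightarrow> solution_upto F T z \<and>
     \<not> (\<exists>T' z'. T < T' \<and> solution_upto F T' z' \<and> (\<forall>t\<ge>0. ereal t < T \<longrightarrow> z' t = z t))"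

text \<open>
  Nonemptiness is required because \<open>infdist\<close> to the empty set is \<open>0\<close> by convention.
\<close>

definition converges_to_set :: "(real \<Rightarrow> 'a::metric_space) \<Rightarrow> 'a set \<Rightarrow> bool" where
  "converges_to_set z K \<longleftrightarrow> K \<noteq> {} \<and> ((\<lambda>t. infdist (z t) K) \<longlongrightarrow> 0) at_top"

definition lyapunov_stable ::
  "('a::real_normed_vector \<Rightarrow> 'a) \<Rightarrow> 'a \<Rightarrow> bool" where
  "lyapunov_stable F z0 \<longleftrightarrow>
     (\<forall>\<epsilon>>0. \<exists>\<delta>>0. \<forall>T z. trajectory F T z \<and> dist (z 0) z0 < \<delta> \<longrightarrow>
        (\<forall>t\<ge>0. ereal t < T \<longrightarrow> dist (z t) z0 < \<epsilon>))"

definition globally_attractive ::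
  "('a::real_normed_vector \<Rightarrow> 'a) \<Rightarrow> 'a \<Rightarrow> bool" where
  "globally_attractive F z0 \<longleftrightarrow>
     (\<forall>T z. trajectory F T z \<longrightarrow> T = \<infinity> \<and> (z \<longlongrightarrow> z0) at_top)"

definition globally_asymptotically_stable ::
  "('a::real_normed_vector \<Rightarrow> 'a) \<Rightarrow> 'a \<Rightarrow> bool" where
  "globally_asymptotically_stable F z0 \<longleftrightarrow>
     F z0 = 0 \<and> lyapunov_stable F z0 \<and> globally_attractive F z0"

end

theory Submission
  imports Defs "HOL-Complex_Analysis.Great_Picard"
begin

text \<open>
  The SPPID dynamics are a preconditioned saddle flow of the augmented Lagrangian, which is convex
  in \<open>x\<close> and concave in \<open>(\<nu>, \<xi>)\<close>. Hence a weighted squared distance \<open>V\<close> to any KKT point satisfies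
  \<open>V' = - 2 D\<close> with a dissipation \<open>D \<ge> 0\<close>, so trajectories are bounded and, by Peano's theorem,
  complete. Where \<open>D\<close> vanishes, \<open>x\<close> is optimal and \<open>\<nu>\<close>, \<open>\<xi>\<close> are at rest, so the augmented
  Lagrangian takes the optimal value there. Barbalat's lemma applied to \<open>V\<close> gives \<open>D \<rightarrow> 0\<close>; the
  augmented Lagrangian therefore converges along the trajectory, and Barbalat's lemma applied to it
  forces \<open>x' \<rightarrow> 0\<close>. This avoids the invariance principle, which would need a semiflow although the
  vector field is not locally Lipschitz.
\<close>

section \<open>Peano's theorem and continuation of bounded solutions\<close>

text \<open>\<open>D \<rightarrow> 0\<close> alone does not identify the limit: \<open>D\<close>
  vanishes at \<open>(xs, \<nu>, \<xi>s)\<close> for every \<open>\<nu>\<close>, whether or not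
  \<open>\<nu>\<close> is a multiplier. What is missing is \<open>grad_L = 0\<close>, and it is
  visible in the rate of the augmented Lagrangian, which on the zero set of \<open>D\<close> reduces
  to minus a positive definite quadratic form in \<open>grad_L\<close>. The augmented Lagrangian
  need not be monotone along solutions, so its convergence cannot come from a sign; it comes from
  the fact that on the zero set its value is \<open>f xs\<close> whatever the multipliers are. Both
  rates are merely continuous functions of the state, so the uniform continuity in Barbalat's lemma
  is drawn from compactness and not from a bound on second derivatives.\<close>

lemma norm_diff_le_vector_derivative:
  fixes z :: "real \<Rightarrow> 'a::banach"
  assumes "a \<le> b" "0 \<le> B"
    and "\<And>t. t \<in> {a..b} \<Longrightarrow> (z has_vector_derivative z' t) (at t within {a..b})"
    and "\<And>t. t \<in> {a..b} \<Longrightarrow> norm (z' t) \<le> B"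
  shows "norm (z b - z a) \<le> B * (b - a)"
proof -
  have "(z' has_integral (z b - z a)) {a..b}"
    using assms(1,3) by (rule fundamental_theorem_of_calculus)
  then have "norm (z b - z a) \<le> B * Henstock_Kurzweil_Integration.content {a..b}"
    using assms(4) by (intro has_integral_bound_real[OF \<open>0 \<le> B\<close>, of "{}"]) auto
  then show ?thesis
    using \<open>a \<le> b\<close> by simp
qed

text \<open>Limits of approximate solutions are taken in the integral equation, which asks nothing
  of derivatives; this lemma returns to the differential form, one-sided at both endpoints.\<close>

lemma has_vector_derivative_integral_equation:
  fixes y :: "real \<Rightarrow> 'a::banach"
  assumes "continuous_on {0..\<tau>} G" "t \<in> {0..\<tau>}"
    and "\<And>t. t \<in> {0..\<tau>} \<Longrightarrow> y t = p + integral {0..t} G"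
  shows "(y has_vector_derivative G t) (at t within {0..\<tau>})"
proof -
  have "((\<lambda>t. p + integral {0..t} G) has_vector_derivative 0 + G t) (at t within {0..\<tau>})"
    by (intro has_vector_derivative_add has_vector_derivative_const
        integral_has_vector_derivative assms)
  then have "((\<lambda>t. p + integral {0..t} G) has_vector_derivative G t) (at t within {0..\<tau>})"
    by simp
  then show ?thesis
    by (rule has_vector_derivative_transform[rotated 2]) (use assms in auto)
qed

text \<open>Tonelli's delay approximations: on \<open>{0..k * h}\<close> the \<open>k\<close>-th iterate solves
  \<open>u' t = F (u (t - h))\<close>.\<close>

primrec tonelli :: "('a \<Rightarrow> 'a::euclidean_space) \<Rightarrow> 'a \<Rightarrow> real \<Rightarrow> nat \<Rightarrow> real \<Rightarrow> 'a" where
  "tonelli F p h 0 = (\<lambda>t. p)"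
| "tonelli F p h (Suc k) = (\<lambda>t. p + integral {0..t} (\<lambda>s. F (tonelli F p h k (max 0 (s - h)))))"

lemma continuous_on_tonelli:
  assumes "continuous_on UNIV F" "0 \<le> h"
  shows "continuous_on {0..\<tau>} (tonelli F p h k)"
proof (induction k)
  case (Suc k)
  have "continuous_on {0..\<tau>} (\<lambda>s. tonelli F p h k (max 0 (s - h)))"
    by (rule continuous_on_compose2[OF Suc]) (use \<open>0 \<le> h\<close> in \<open>auto intro!: continuous_intros\<close>)
  then have "continuous_on {0..\<tau>} (\<lambda>s. F (tonelli F p h k (max 0 (s - h))))"
    by (rule continuous_on_compose2[OF assms(1)]) auto
  then have "(tonelli F p h (Suc k) has_vector_derivative F (tonelli F p h k (max 0 (t - h))))
      (at t within {0..\<tau>})" if "t \<in> {0..\<tau>}" for t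
    by (rule has_vector_derivative_integral_equation) (use that in auto)
  then show ?case
    by (intro continuous_on_vector_derivative) auto
qed auto

text \<open>An iterate reads its predecessor only at the delayed time \<open>max 0 (s - h)\<close>,
  so each round extends the interval of agreement by one delay: after \<open>k\<close> rounds the
  values on \<open>{0..k * h}\<close> are final.\<close>

lemma tonelli_Suc_eq:
  assumes "0 \<le> t" "t \<le> real k * h" "0 \<le> h"
  shows "tonelli F p h (Suc k) t = tonelli F p h k t"
  using assms
proof (induction k arbitrary: t)
  case (Suc k)
  have "tonelli F p h (Suc k) (max 0 (s - h)) = tonelli F p h k (max 0 (s - h))"
    if "s \<in> {0..t}" for s
    using Suc.prems that by (intro Suc.IH) (auto simp: algebra_simps)
  then have "integral {0..t} (\<lambda>s. F (tonelli F p h (Suc k) (max 0 (s - h))))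
      = integral {0..t} (\<lambda>s. F (tonelli F p h k (max 0 (s - h))))"
    by (intro integral_cong) presburger
  then show ?case
    unfolding tonelli.simps(2)[of F p h "Suc k"] tonelli.simps(2)[of F p h k] by simp
qed auto

text \<open>Without a Lipschitz condition there is no contraction, so the solution is a limit point
  of delay approximations. The global bound \<open>B\<close> makes them uniformly
  \<open>B\<close>-Lipschitz, which gives the equicontinuity for Arzela-Ascoli.\<close>

lemma peano_bounded:
  fixes F :: "'a::euclidean_space \<Rightarrow> 'a"
  assumes F: "continuous_on UNIV F" and B: "\<And>x. norm (F x) \<le> B" and "0 < \<tau>"
  obtains y where "y 0 = p"
    "\<And>t. t \<in> {0..\<tau>} \<Longrightarrow> (y has_vector_derivative F (y t)) (at t within {0..\<tau>})"
proof -
  have "0 \<le> B"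
    using B norm_ge_zero order_trans by blast
  \<comment> \<open>\<open>Suc n\<close> delays of length \<open>h n\<close> fill
    \<open>{0..\<tau>}\<close> exactly, so the iterate of index \<open>Suc n\<close> is a true delay
    solution on the whole interval.\<close>
  define h where "h n = \<tau> / real (Suc n)" for n
  have h: "0 < h n" for n
    using \<open>0 < \<tau>\<close> by (simp add: h_def)
  have h0: "h \<longlonglongrightarrow> 0"
    unfolding h_def using LIMSEQ_Suc[OF lim_const_over_n[of \<tau>]] by simp
  define v where "v n = tonelli F p (h n) (Suc n)" for n
  define w where "w n s = F (v n (max 0 (s - h n)))" for n s
  have cv: "continuous_on {0..\<tau>} (v n)" for n
    unfolding v_def using F h[of n] by (intro continuous_on_tonelli) auto
  have cw: "continuous_on {0..\<tau>} (w n)" for n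
    unfolding w_def
  proof (rule continuous_on_compose2[OF F])
    show "continuous_on {0..\<tau>} (\<lambda>s. v n (max 0 (s - h n)))"
      by (rule continuous_on_compose2[OF cv])
        (use h[of n] in \<open>auto intro!: continuous_intros\<close>)
  qed auto
  have v: "v n t = p + integral {0..t} (w n)" if "t \<in> {0..\<tau>}" for n t
  proof -
    have "real (Suc n) * h n = \<tau>"
      by (simp add: h_def)
    then have "v n t = tonelli F p (h n) (Suc (Suc n)) t"
      unfolding v_def using that h[of n] by (intro tonelli_Suc_eq[symmetric]) auto
    then show ?thesis
      unfolding tonelli.simps(2)[of F p "h n" "Suc n"] v_def[symmetric] w_def[symmetric] by simp
  qed
  have dv: "(v n has_vector_derivative w n t) (at t within {0..\<tau>})" if "t \<in> {0..\<tau>}" for n t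
    using cw that v by (rule has_vector_derivative_integral_equation)
  have lip1: "norm (v n t - v n s) \<le> B * (t - s)" if "0 \<le> s" "s \<le> t" "t \<le> \<tau>" for n s t
    using that \<open>0 \<le> B\<close> B
    by (intro norm_diff_le_vector_derivative[where z' = "w n"])
      (auto simp: w_def intro!: has_vector_derivative_within_subset[OF dv[unfolded w_def]])
  have lip: "norm (v n s - v n t) \<le> B * \<bar>s - t\<bar>" if "s \<in> {0..\<tau>}" "t \<in> {0..\<tau>}" for n s t
    using lip1[of s t n] lip1[of t s n] that by (cases "s \<le> t") (auto simp: norm_minus_commute)
  have v0: "v n 0 = p" for n
    using v[of 0] \<open>0 < \<tau>\<close> by simp
  obtain g k where g: "continuous_on {0..\<tau>} g" "strict_mono (k :: nat \<Rightarrow> nat)"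
    and gk: "\<And>e. 0 < e \<Longrightarrow> \<exists>N. \<forall>n x. n \<ge> N \<and> x \<in> {0..\<tau>} \<longrightarrow> norm (v (k n) x - g x) < e"
  proof (rule Arzela_Ascoli[of "{0..\<tau>}" v "norm p + B * \<tau>"])
    fix n t assume t: "t \<in> {0..\<tau>}"
    have "norm (v n t - p) \<le> B * \<bar>t - 0\<bar>"
      using lip[of t 0 n] t \<open>0 < \<tau>\<close> v0 by simp
    also have "\<dots> \<le> B * \<tau>"
      using t \<open>0 \<le> B\<close> by (intro mult_left_mono) auto
    finally show "norm (v n t) \<le> norm p + B * \<tau>"
      using norm_triangle_sub[of "v n t" p] by linarith
  next
    fix s e :: real assume s: "s \<in> {0..\<tau>}" "0 < e"
    show "\<exists>d. 0 < d \<and> (\<forall>n t. t \<in> {0..\<tau>} \<and> norm (s - t) < d \<longrightarrow> norm (v n s - v n t) < e)"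
    \<comment> \<open>The denominator is \<open>B + 1\<close> because \<open>B\<close> may be
      \<open>0\<close>.\<close>
    proof (intro exI[of _ "e / (B + 1)"] conjI allI impI)
      fix n t assume t: "t \<in> {0..\<tau>} \<and> norm (s - t) < e / (B + 1)"
      have "norm (v n s - v n t) \<le> (B + 1) * \<bar>s - t\<bar>"
        using lip[of s t n] s t by (simp add: distrib_right add_increasing2)
      also have "\<dots> < e"
        using t \<open>0 \<le> B\<close> by (simp add: pos_less_divide_eq mult.commute)
      finally show "norm (v n s - v n t) < e" .
    qed (use \<open>0 < e\<close> \<open>0 \<le> B\<close> in auto)
  qed auto
  have lim_g: "(\<lambda>n. v (k n) t) \<longlonglongrightarrow> g t" if "t \<in> {0..\<tau>}" for t
    unfolding LIMSEQ_iff using gk that by meson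
  have hk0: "(\<lambda>n. h (k n)) \<longlonglongrightarrow> 0"
    using LIMSEQ_subseq_LIMSEQ[OF h0 g(2)] by (simp add: o_def)
  have lim_w: "(\<lambda>n. w (k n) s) \<longlonglongrightarrow> F (g s)" if s: "s \<in> {0..\<tau>}" for s
  proof -
    \<comment> \<open>The delay disappears in the limit: the shift in time is at most
      \<open>h (k n)\<close>.\<close>
    have delay: "norm (v (k n) (max 0 (s - h (k n))) - v (k n) s) \<le> B * h (k n)" for n
    proof -
      have "norm (v (k n) (max 0 (s - h (k n))) - v (k n) s) \<le> B * \<bar>max 0 (s - h (k n)) - s\<bar>"
        using s h[of "k n"] by (intro lip) auto
      also have "\<dots> \<le> B * h (k n)"
        using s h[of "k n"] \<open>0 \<le> B\<close> by (intro mult_left_mono) auto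
      finally show ?thesis .
    qed
    have "(\<lambda>n. v (k n) (max 0 (s - h (k n))) - v (k n) s) \<longlonglongrightarrow> 0"
      by (rule Lim_null_comparison[OF always_eventually[OF allI[OF delay]]
            tendsto_mult_right_zero[OF hk0]])
    from tendsto_add[OF this lim_g[OF s]]
    have "(\<lambda>n. v (k n) (max 0 (s - h (k n)))) \<longlonglongrightarrow> g s"
      by simp
    then show ?thesis
      unfolding w_def using continuous_on_tendsto_compose[OF F] by auto
  qed
  have "g t = p + integral {0..t} (\<lambda>s. F (g s))" if t: "t \<in> {0..\<tau>}" for t
  proof -
    have "(\<lambda>n. integral {0..t} (w (k n))) \<longlonglongrightarrow> integral {0..t} (\<lambda>s. F (g s))"
    proof (rule dominated_convergence)
      show "w (k n) integrable_on {0..t}" for n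
        using t by (intro integrable_continuous_real continuous_on_subset[OF cw]) auto
      show "(\<lambda>_. B) integrable_on {0..t}"
        by (rule integrable_const_ivl)
      show "norm (w (k n) s) \<le> B" for n s
        unfolding w_def by (rule B)
      show "(\<lambda>n. w (k n) s) \<longlonglongrightarrow> F (g s)" if "s \<in> {0..t}" for s
        using t that by (intro lim_w) auto
    qed
    from tendsto_add[OF tendsto_const[of p] this]
    have "(\<lambda>n. v (k n) t) \<longlonglongrightarrow> p + integral {0..t} (\<lambda>s. F (g s))"
      using v[OF t] by simp
    then show ?thesis
      using lim_g[OF t] LIMSEQ_unique by blast
  qed
  then have "(g has_vector_derivative F (g t)) (at t within {0..\<tau>})" if "t \<in> {0..\<tau>}" for t
    using that by (intro has_vector_derivative_integral_equation[where G = "\<lambda>s. F (g s)"]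
        continuous_on_compose2[OF F g(1)]) auto
  moreover have "g 0 = p"
    using lim_g[of 0] v0 \<open>0 < \<tau>\<close> by (simp add: LIMSEQ_const_iff)
  ultimately show thesis
    by (rule that[rotated])
qed

text \<open>Projecting onto \<open>cball p 1\<close> before applying \<open>F\<close> gives a
  bounded field. With speed at most \<open>B\<close> its solution stays in the ball up to time
  \<open>1 / B\<close>, and there the projection changes nothing.\<close>

lemma peano:
  fixes F :: "'a::euclidean_space \<Rightarrow> 'a"
  assumes F: "continuous_on UNIV F"
  obtains y \<tau> where "0 < \<tau>" "y 0 = p"
    "\<And>t. t \<in> {0..\<tau>} \<Longrightarrow> (y has_vector_derivative F (y t)) (at t within {0..\<tau>})"
proof -
  define c where "c = closest_point (cball p 1)"
  have c: "continuous_on UNIV c" "c x \<in> cball p 1" "x \<in> cball p 1 \<Longrightarrow> c x = x" for x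
    unfolding c_def
    by (auto intro!: continuous_on_closest_point closest_point_self
        simp del: mem_cball)
      (metis closest_point_in_set closed_cball mem_cball centre_in_cball empty_iff zero_le_one)
  have "compact (F ` cball p 1)"
    by (intro compact_continuous_image continuous_on_subset[OF F]) auto
  then obtain B where B: "0 < B" "\<And>x. x \<in> cball p 1 \<Longrightarrow> norm (F x) \<le> B"
    using compact_imp_bounded bounded_pos by (metis imageI)
  define \<tau> where "\<tau> = 1 / B"
  have "0 < \<tau>" "B * \<tau> = 1"
    using B by (auto simp: \<tau>_def)
  obtain y where y: "y 0 = p"
    "\<And>t. t \<in> {0..\<tau>} \<Longrightarrow> (y has_vector_derivative F (c (y t))) (at t within {0..\<tau>})"
  proof (rule peano_bounded[of "\<lambda>x. F (c x)" B \<tau> p])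
    show "continuous_on UNIV (\<lambda>x. F (c x))"
      by (rule continuous_on_compose2[OF F c(1)]) auto
    show "norm (F (c x)) \<le> B" for x
      using B(2) c(2) by blast
  qed (use \<open>0 < \<tau>\<close> in auto)
  have "y t \<in> cball p 1" if t: "t \<in> {0..\<tau>}" for t
  proof -
    have "norm (y t - y 0) \<le> B * (t - 0)"
      using t B c(2)
      by (intro norm_diff_le_vector_derivative[where z' = "\<lambda>t. F (c (y t))"])
        (auto intro!: has_vector_derivative_within_subset[OF y(2)])
    also have "\<dots> \<le> B * \<tau>"
      using t B by auto
    finally show ?thesis
      using y(1) \<open>B * \<tau> = 1\<close> by (simp add: dist_norm norm_minus_commute)
  qed
  then show thesis
    using y c(3) that[of \<tau> y] \<open>0 < \<tau>\<close> by metis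
qed

text \<open>Boundedness of the state bounds the velocity, so the solution is Lipschitz and has a
  limit at a finite \<open>T\<close>. Restarting there by Peano's theorem gives a longer solution,
  against maximality.\<close>

lemma bounded_trajectory_complete:
  fixes F :: "'a::euclidean_space \<Rightarrow> 'a"
  assumes F: "continuous_on UNIV F" and z: "trajectory F T z"
    and R: "\<And>t. 0 \<le> t \<Longrightarrow> ereal t < T \<Longrightarrow> norm (z t) \<le> R"
  shows "T = \<infinity>"
proof (rule ccontr)
  assume "T \<noteq> \<infinity>"
  moreover have "0 < T"
    and dz: "\<And>t. 0 \<le> t \<Longrightarrow> ereal t < T \<Longrightarrow> (z has_vector_derivative F (z t)) (at t within {0..})"
    using z by (auto simp: trajectory_def solution_upto_def)
  ultimately obtain a where T: "T = ereal a" and "0 < a"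
    by (cases T) auto
  have "compact (F ` cball 0 R)"
    by (intro compact_continuous_image continuous_on_subset[OF F]) auto
  then obtain B where B: "0 < B" "\<And>x. x \<in> cball 0 R \<Longrightarrow> norm (F x) \<le> B"
    using compact_imp_bounded bounded_pos by (metis imageI)
  have lip1: "norm (z t - z s) \<le> B * (t - s)" if "0 \<le> s" "s \<le> t" "t < a" for s t
    using that B R
    by (intro norm_diff_le_vector_derivative[where z' = "\<lambda>t. F (z t)"])
      (auto simp: T intro!: has_vector_derivative_within_subset[OF dz])
  have "B-lipschitz_on {0..<a} z"
    using lip1 B(1) unfolding lipschitz_on_def dist_norm
    by (auto, smt (verit) norm_minus_commute)
  then obtain w where w: "B-lipschitz_on (closure {0..<a}) w" "\<forall>t\<in>{0..<a}. w t = z t"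
    using lipschitz_extend_closure by blast
  have wc: "continuous_on {0..a} w"
    using lipschitz_on_continuous_on[OF w(1)] \<open>0 < a\<close> by simp
  have Fw: "continuous_on {0..a} (\<lambda>t. F (w t))"
    by (rule continuous_on_compose2[OF F wc]) auto
  \<comment> \<open>The differential equation says nothing at the right endpoint \<open>a\<close>.
    Both sides of the integral form are continuous, so it passes from \<open>{0..<a}\<close> to the
    closure.\<close>
  have weq: "w t = w 0 + integral {0..t} (\<lambda>s. F (w s))" if t: "t \<in> {0..a}" for t
  proof -
    have *: "w x = w 0 + integral {0..x} (\<lambda>s. F (w s))" if x: "x \<in> {0..<a}" for x
    proof -
      have "((\<lambda>s. F (w s)) has_integral (w x - w 0)) {0..x}"
      proof (rule fundamental_theorem_of_calculus)
        fix s assume s: "s \<in> {0..x}"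
        have "(z has_vector_derivative F (z s)) (at s within {0..x})"
          using s x by (intro has_vector_derivative_within_subset[OF dz]) (auto simp: T)
        then have "(w has_vector_derivative F (z s)) (at s within {0..x})"
          by (rule has_vector_derivative_transform[rotated 2]) (use s x w(2) in auto)
        then show "(w has_vector_derivative F (w s)) (at s within {0..x})"
          using s x w(2) by auto
      qed (use x in auto)
      then show ?thesis
        by (simp add: integral_unique)
    qed
    have c1: "continuous_on (closure {0..<a}) (\<lambda>t. w 0 + integral {0..t} (\<lambda>s. F (w s)))"
      using Fw \<open>0 < a\<close>
      by (auto intro!: continuous_intros indefinite_integral_continuous_1 integrable_continuous_real)
    have c2: "continuous_on (closure {0..<a}) w"
      using wc \<open>0 < a\<close> by simp
    have "w t - (w 0 + integral {0..t} (\<lambda>s. F (w s))) = 0"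
    proof (rule continuous_constant_on_closure[where x = t
          and f = "\<lambda>t. w t - (w 0 + integral {0..t} (\<lambda>s. F (w s)))"])
      show "continuous_on (closure {0..<a}) (\<lambda>t. w t - (w 0 + integral {0..t} (\<lambda>s. F (w s))))"
        using c2 c1 by (rule continuous_on_diff)
      show "w x - (w 0 + integral {0..x} (\<lambda>s. F (w s))) = 0" if "x \<in> {0..<a}" for x
        using *[OF that] by simp
      show "t \<in> closure {0..<a}"
        using t \<open>0 < a\<close> by simp
    qed
    then show ?thesis
      by simp
  qed
  have dw: "(w has_vector_derivative F (w t)) (at t within {0..a})" if "t \<in> {0..a}" for t
    using Fw that weq by (rule has_vector_derivative_integral_equation)
  obtain y \<tau> where "0 < \<tau>" and y: "y 0 = w a"
    "\<And>t. t \<in> {0..\<tau>} \<Longrightarrow> (y has_vector_derivative F (y t)) (at t within {0..\<tau>})"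
    using peano[OF F] by blast
  have dy: "((\<lambda>t. y (t - a)) has_vector_derivative F (y (t - a))) (at t within {a..a+\<tau>})"
    if t: "t \<in> {a..a+\<tau>}" for t
  proof -
    have "(y has_vector_derivative F (y (t - a))) (at (t - a) within (\<lambda>t. t - a) ` {a..a+\<tau>})"
      using t by (intro has_vector_derivative_within_subset[OF y(2)]) auto
    moreover have "((\<lambda>t. t - a) has_vector_derivative 1) (at t within {a..a+\<tau>})"
      by (auto intro!: derivative_eq_intros)
    ultimately show ?thesis
      using vector_diff_chain_within[of "\<lambda>t. t - a" 1 t "{a..a+\<tau>}" y "F (y (t - a))"]
      by (simp add: o_def)
  qed
  \<comment> \<open>At \<open>a\<close> both branches have the value \<open>w a\<close> and the
    one-sided derivative \<open>F (w a)\<close>, so the glued function is a solution across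
    \<open>a\<close>.\<close>
  define u where "u t = (if t \<in> {0..a} then w t else y (t - a))" for t
  have du: "(u has_vector_derivative F (u t)) (at t within {0..a+\<tau>})" if t: "t \<in> {0..a+\<tau>}" for t
  proof -
    have "((\<lambda>t. if t \<in> {0..a} then w t else y (t - a)) has_vector_derivative
        (if t \<in> {0..a} then F (w t) else F (y (t - a)))) (at t within {0..a+\<tau>})"
    proof (rule has_vector_derivative_If_within_closures)
      have cl: "closure {0..a} \<inter> closure {a<..a+\<tau>} = {a}"
          "{0..a} \<union> {a} = {0..a}" "{a<..a+\<tau>} \<union> {a} = {a..a+\<tau>}"
        using \<open>0 < a\<close> \<open>0 < \<tau>\<close> by auto
      show "t \<in> {0..a} \<union> {a<..a+\<tau>}" "{0..a+\<tau>} = {0..a} \<union> {a<..a+\<tau>}"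
        using t \<open>0 < a\<close> \<open>0 < \<tau>\<close> by auto
      show "(w has_vector_derivative F (w t))
          (at t within {0..a} \<union> closure {0..a} \<inter> closure {a<..a+\<tau>})"
        if "t \<in> {0..a} \<union> closure {0..a} \<inter> closure {a<..a+\<tau>}"
        using that dw unfolding cl by blast
      show "((\<lambda>t. y (t - a)) has_vector_derivative F (y (t - a)))
          (at t within {a<..a+\<tau>} \<union> closure {0..a} \<inter> closure {a<..a+\<tau>})"
        if "t \<in> {a<..a+\<tau>} \<union> closure {0..a} \<inter> closure {a<..a+\<tau>}"
        using that dy unfolding cl by blast
    qed (use \<open>0 < a\<close> \<open>0 < \<tau>\<close> y(1) in auto)
    then show ?thesis
      unfolding u_def by (auto split: if_splits)
  qed
  have "solution_upto F (ereal (a + \<tau>)) u"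
    unfolding solution_upto_def
  proof (intro conjI allI impI)
    fix t assume t: "0 \<le> t" "ereal t < ereal (a + \<tau>)"
    have "at t within {0..a+\<tau>} = at t within {0..}"
      by (rule at_within_nhd[of t "{..<a+\<tau>}"]) (use t in auto)
    then show "(u has_vector_derivative F (u t)) (at t within {0..})"
      using du[of t] t by simp
  qed (use \<open>0 < a\<close> \<open>0 < \<tau>\<close> in auto)
  moreover have "\<forall>t\<ge>0. ereal t < T \<longrightarrow> u t = z t"
    using w(2) by (auto simp: T u_def)
  moreover have "T < ereal (a + \<tau>)"
    using \<open>0 < \<tau>\<close> by (simp add: T)
  ultimately show False
    using z unfolding trajectory_def by blast
qed

section \<open>Asymptotics of real functions\<close>

text \<open>The increment of \<open>V\<close> over a window of fixed length tends to
  \<open>0\<close>, and uniform continuity keeps this increment close to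
  \<open>\<delta> * w t\<close>; hence \<open>w t\<close> is small.\<close>

lemma barbalat:
  fixes V :: "real \<Rightarrow> real"
  assumes dV: "\<And>t. 0 \<le> t \<Longrightarrow> (V has_vector_derivative w t) (at t within {0..})"
    and V: "(V \<longlongrightarrow> l) at_top"
    and w: "uniformly_continuous_on {0..} w"
  shows "(w \<longlongrightarrow> 0) at_top"
proof (rule tendstoI)
  fix e :: real assume "0 < e"
  then obtain d where "0 < d"
    and d: "\<And>s t. 0 \<le> s \<Longrightarrow> 0 \<le> t \<Longrightarrow> dist t s < d \<Longrightarrow> dist (w t) (w s) < e / 2"
    using w unfolding uniformly_continuous_on_def
    by (metis atLeast_iff half_gt_zero)
  define \<delta> where "\<delta> = d / 2"
  have \<delta>: "0 < \<delta>" "\<delta> < d"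
    using \<open>0 < d\<close> by (auto simp: \<delta>_def)
  have "((\<lambda>t. V (t + \<delta>)) \<longlongrightarrow> l) at_top"
    using filterlim_tendsto_add_at_top[OF tendsto_const[of \<delta>] filterlim_ident]
    by (intro filterlim_compose[OF V]) (simp add: add.commute)
  from tendsto_diff[OF this V] have "((\<lambda>t. V (t + \<delta>) - V t) \<longlongrightarrow> 0) at_top"
    by simp
  then have "\<forall>\<^sub>F t in at_top. dist (V (t + \<delta>) - V t) 0 < \<delta> * (e / 2)"
    using \<open>0 < e\<close> \<delta> by (intro tendstoD) auto
  then show "\<forall>\<^sub>F t in at_top. dist (w t) 0 < e"
    using eventually_ge_at_top[of 0]
  proof eventually_elim
    case (elim t)
    \<comment> \<open>Subtracting the line of slope \<open>w t\<close> leaves a function with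
      derivative \<open>w s - w t\<close>, which is at most \<open>e / 2\<close> in size on the
      window.\<close>
    have "norm ((V (t + \<delta>) - (t + \<delta>) * w t) - (V t - t * w t)) \<le> e / 2 * ((t + \<delta>) - t)"
    proof (rule norm_diff_le_vector_derivative[where z' = "\<lambda>s. w s - w t"])
      fix s assume s: "s \<in> {t..t + \<delta>}"
      have "(V has_vector_derivative w s) (at s within {t..t+\<delta>})"
        using s elim by (intro has_vector_derivative_within_subset[OF dV]) auto
      then show "((\<lambda>s. V s - s * w t) has_vector_derivative w s - w t) (at s within {t..t + \<delta>})"
        by (auto intro!: derivative_eq_intros)
      show "norm (w s - w t) \<le> e / 2"
        using d[of t s] s elim \<delta> by (auto simp: dist_real_def)
    qed (use \<delta> \<open>0 < e\<close> in auto)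
    then have "\<bar>(V (t + \<delta>) - V t) - \<delta> * w t\<bar> \<le> \<delta> * (e / 2)"
      by (simp add: algebra_simps)
    then have "\<bar>\<delta> * w t\<bar> < \<delta> * e"
      using elim(1) unfolding dist_real_def by linarith
    then have "\<delta> * \<bar>w t\<bar> < \<delta> * e"
      using \<delta> by (simp add: abs_mult)
    then show ?case
      using \<delta> by simp
  qed
qed

text \<open>On the compact part of \<open>S\<close> where \<open>E\<close> is at distance at least
  \<open>e\<close> from \<open>c\<close>, the absolute value of \<open>D\<close> has a positive
  minimum, so a small \<open>D (z t)\<close> excludes that part. The path \<open>z\<close> itself
  need not converge.\<close>

lemma tendsto_along_zeros:
  fixes z :: "real \<Rightarrow> 'a::euclidean_space" and D E :: "'a \<Rightarrow> real"
  assumes "compact S" "continuous_on S D" "continuous_on S E"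
    and "\<And>t. 0 \<le> t \<Longrightarrow> z t \<in> S"
    and "((\<lambda>t. D (z t)) \<longlongrightarrow> 0) at_top"
    and "\<And>x. x \<in> S \<Longrightarrow> D x = 0 \<Longrightarrow> E x = c"
  shows "((\<lambda>t. E (z t)) \<longlongrightarrow> c) at_top"
proof (rule tendstoI)
  fix e :: real assume "0 < e"
  define K where "K = {x \<in> S. e \<le> dist (E x) c}"
  have "compact K"
  proof -
    have "closedin (top_of_set S) (S \<inter> (\<lambda>x. dist (E x) c) -` {e..})"
      by (intro continuous_closedin_preimage continuous_intros assms)
    moreover have "S \<inter> (\<lambda>x. dist (E x) c) -` {e..} = K"
      by (auto simp: K_def)
    ultimately show ?thesis
      using closedin_compact \<open>compact S\<close> by auto
  qed
  have "\<exists>\<delta>>0. \<forall>x\<in>K. \<delta> \<le> \<bar>D x\<bar>"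
  proof (cases "K = {}")
    case False
    have "continuous_on K (\<lambda>x. \<bar>D x\<bar>)"
      by (intro continuous_intros continuous_on_subset[OF assms(2)]) (auto simp: K_def)
    then obtain x where "x \<in> K" "\<forall>y\<in>K. \<bar>D x\<bar> \<le> \<bar>D y\<bar>"
      using continuous_attains_inf \<open>compact K\<close> False by blast
    moreover have "D x \<noteq> 0"
      using \<open>x \<in> K\<close> assms(6)[of x] \<open>0 < e\<close> by (auto simp: K_def)
    ultimately show ?thesis
      by (intro exI[of _ "\<bar>D x\<bar>"]) auto
  qed (auto intro: exI[of _ 1])
  then obtain \<delta> where \<delta>: "0 < \<delta>" "\<And>x. x \<in> K \<Longrightarrow> \<delta> \<le> \<bar>D x\<bar>"
    by blast
  have "\<forall>\<^sub>F t in at_top. dist (D (z t)) 0 < \<delta>"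
    using assms(5) \<delta>(1) by (rule tendstoD)
  then show "\<forall>\<^sub>F t in at_top. dist (E (z t)) c < e"
    using eventually_ge_at_top[of 0]
  proof eventually_elim
    case (elim t)
    then have "z t \<notin> K"
      using \<delta>(2)[of "z t"] by auto
    then show ?case
      using assms(4) elim by (auto simp: K_def)
  qed
qed

lemma bounded_antimono_convergent_at_top:
  fixes h :: "real \<Rightarrow> real"
  assumes "\<And>s t. 0 \<le> s \<Longrightarrow> s \<le> t \<Longrightarrow> h t \<le> h s" "\<And>t. 0 \<le> t \<Longrightarrow> m \<le> h t"
  obtains l where "(h \<longlongrightarrow> l) at_top"
proof -
  define l where "l = Inf (h ` {0..})"
  have bdd: "bdd_below (h ` {0..})"
    using assms(2) by (auto intro!: bdd_belowI[of _ m])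
  have "(h \<longlongrightarrow> l) at_top"
  proof (rule order_tendstoI)
    fix a assume "a < l"
    have "l \<le> h t" if "0 \<le> t" for t
      unfolding l_def using that by (intro cInf_lower bdd) auto
    then show "\<forall>\<^sub>F t in at_top. a < h t"
      using \<open>a < l\<close> by (intro eventually_at_top_linorderI[of 0]) (auto intro: less_le_trans)
  next
    fix a assume "l < a"
    then obtain s where "0 \<le> s" "h s < a"
      unfolding l_def using bdd by (subst (asm) cInf_less_iff) auto
    then show "\<forall>\<^sub>F t in at_top. h t < a"
      using assms(1) by (intro eventually_at_top_linorderI[of s]) (auto intro: le_less_trans)
  qed
  then show thesis
    by (rule that)
qed

section \<open>Gradients and KKT points of convex programs\<close>

lemma GDERIV_gradient:
  assumes "f differentiable (at x)"
  shows "GDERIV f x :> gradient f x"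
proof -
  obtain f' where f': "(f has_derivative f') (at x)"
    using assms by (auto simp: differentiable_def)
  have lin: "linear f'"
    using f' by (rule has_derivative_linear)
  \<comment> \<open>\<open>adjoint f' 1\<close> is the Riesz representative of the functional
    \<open>f'\<close>.\<close>
  have "f' = (\<lambda>h. h \<bullet> adjoint f' 1)"
    using adjoint_works[OF lin, of _ 1] by (auto simp: fun_eq_iff)
  then have D: "GDERIV f x :> adjoint f' 1"
    using f' by (simp add: gderiv_def)
  moreover have "d = adjoint f' 1" if "GDERIV f x :> d" for d
  proof -
    have "(\<lambda>h. h \<bullet> d) = (\<lambda>h. h \<bullet> adjoint f' 1)"
      using that D unfolding gderiv_def by (rule has_derivative_unique)
    then show ?thesis
      by (metis vector_eq_ldot)
  qed
  ultimately show ?thesis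
    unfolding gradient_def by (rule theI)
qed

lemma has_field_derivative_along_line:
  assumes "GDERIV f x :> d"
  shows "((\<lambda>t. f (x + t *\<^sub>R v)) has_field_derivative (v \<bullet> d)) (at 0)"
proof -
  have "(f has_derivative (\<lambda>h. h \<bullet> d)) (at (x + 0 *\<^sub>R v))"
    using assms by (simp add: gderiv_def)
  moreover have "((\<lambda>t. x + t *\<^sub>R v) has_derivative (\<lambda>t. t *\<^sub>R v)) (at 0)"
    by (auto intro!: derivative_eq_intros)
  ultimately have "((\<lambda>t. f (x + t *\<^sub>R v)) has_derivative (\<lambda>t. (t *\<^sub>R v) \<bullet> d)) (at 0)"
    using has_derivative_compose by blast
  moreover have "(\<lambda>t. (t *\<^sub>R v) \<bullet> d) = (*) (v \<bullet> d)"
    by (auto simp: fun_eq_iff)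
  ultimately show ?thesis
    by (simp add: has_field_derivative_def)
qed

lemma convex_on_above_gradient:
  fixes f :: "'a::real_inner \<Rightarrow> real"
  assumes "convex_on UNIV f" "GDERIV f x :> d"
  shows "f x + d \<bullet> (y - x) \<le> f y"
proof -
  let ?\<phi> = "\<lambda>t. f (x + t *\<^sub>R (y - x))"
  have "convex_on UNIV ?\<phi>"
  proof (rule convex_onI)
    fix t u v :: real assume "0 < t" "t < 1"
    have "x + ((1 - t) *\<^sub>R u + t *\<^sub>R v) *\<^sub>R (y - x)
        = (1 - t) *\<^sub>R (x + u *\<^sub>R (y - x)) + t *\<^sub>R (x + v *\<^sub>R (y - x))"
      by (simp add: algebra_simps)
    then show "?\<phi> ((1 - t) *\<^sub>R u + t *\<^sub>R v) \<le> (1 - t) * ?\<phi> u + t * ?\<phi> v"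
      using convex_onD[OF assms(1)] \<open>0 < t\<close> \<open>t < 1\<close> by simp
  qed auto
  then have "((y - x) \<bullet> d) * (1 - 0) \<le> ?\<phi> 1 - ?\<phi> 0"
    by (rule convex_on_imp_above_tangent)
      (use has_field_derivative_along_line[OF assms(2)] in auto)
  then show ?thesis
    by (simp add: inner_commute)
qed

lemma eventually_decrease_along_line:
  assumes "GDERIV f x :> d" "v \<bullet> d < 0"
  shows "\<forall>\<^sub>F t in at_right 0. f (x + t *\<^sub>R v) < f x"
  using has_real_derivative_neg_dec_right[OF has_field_derivative_along_line[OF assms(1)] assms(2)]
  unfolding eventually_at_right_field by auto

text \<open>Convexity is available one constraint at a time, so the Jacobian term has to be split
  into component gradients. Differentiability of \<open>g\<close> itself is assembled from its
  components first, since \<open>jacobian\<close> is meaningful only then.\<close>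

lemma transpose_jacobian_mult:
  fixes g :: "real^'n \<Rightarrow> real^'m"
  assumes "\<And>i. (\<lambda>y. g y $ i) differentiable (at x)"
  shows "transpose (jacobian g (at x)) *v r = (\<Sum>i\<in>UNIV. r $ i *\<^sub>R gradient (\<lambda>y. g y $ i) x)"
proof -
  define g' where "g' h = (\<chi> i. gradient (\<lambda>y. g y $ i) x \<bullet> h)" for h
  have "(g has_derivative g') (at x)"
  proof (subst has_derivative_componentwise_within, safe)
    fix e :: "real^'m" assume "e \<in> Basis"
    then obtain i where "e = axis i 1"
      by (auto simp: Basis_vec_def)
    moreover have "((\<lambda>y. g y $ i) has_derivative (\<lambda>h. gradient (\<lambda>y. g y $ i) x \<bullet> h)) (at x)"
      using GDERIV_gradient[OF assms[of i]] by (simp add: gderiv_def inner_commute)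
    ultimately show "((\<lambda>y. g y \<bullet> e) has_derivative (\<lambda>h. g' h \<bullet> e)) (at x)"
      by (simp add: inner_axis g'_def)
  qed
  then have "(\<lambda>h. jacobian g (at x) *v h) = g'"
    using jacobian_works has_derivative_unique differentiable_def by metis
  then have J: "jacobian g (at x) *v h = g' h" for h
    by metis
  have "(transpose (jacobian g (at x)) *v r) \<bullet> h
      = (\<Sum>i\<in>UNIV. r $ i *\<^sub>R gradient (\<lambda>y. g y $ i) x) \<bullet> h" for h
    unfolding transpose_matrix_vector dot_lmul_matrix J
    by (simp add: g'_def inner_vec_def[of r] inner_sum_left)
  then show ?thesis
    using vector_eq_rdot by blast
qed

lemma vector_matrix_mult_rows: "\<nu> v* A = (\<Sum>j\<in>UNIV. \<nu> $ j *\<^sub>R row j A)"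
  for A :: "real^'n^'p"
  by (simp add: vec_eq_iff vector_matrix_mult_def row_def mult.commute)

lemma axis_vector_matrix_mult: "axis j 1 v* A = row j A" for A :: "real^'n^'p"
proof -
  have "axis j 1 v* A = (\<Sum>k\<in>UNIV. if k = j then row k A else 0)"
    unfolding vector_matrix_mult_rows by (intro sum.cong) (auto simp: axis_def)
  then show ?thesis
    by simp
qed

text \<open>The kink of \<open>max u 0\<close> disappears on squaring, which makes the augmented
  Lagrangian differentiable along solutions. In each sign pattern of \<open>u\<close> and
  \<open>u + h\<close> the first-order remainder is at most \<open>h\<^sup>2\<close>.\<close>

lemma DERIV_relu_square: "((\<lambda>u::real. (max u 0)\<^sup>2) has_field_derivative 2 * max u 0) (at u)"
proof -
  have "\<bar>((max (u + h) 0)\<^sup>2 - (max u 0)\<^sup>2) / h - 2 * max u 0\<bar> \<le> \<bar>h\<bar>" if "h \<noteq> 0" for h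
  proof -
    have "\<bar>(max (u + h) 0)\<^sup>2 - (max u 0)\<^sup>2 - 2 * max u 0 * h\<bar> \<le> h\<^sup>2"
    proof (cases "0 \<le> u"; cases "0 \<le> u + h")
      assume "0 \<le> u" "\<not> 0 \<le> u + h"
      then have "u * (u + h) \<le> 0" "0 \<le> (u + h)\<^sup>2"
        by (auto simp: mult_le_0_iff)
      moreover have "h * u \<le> 0" "0 \<le> h * h"
        using \<open>0 \<le> u\<close> \<open>\<not> 0 \<le> u + h\<close> by (auto simp: mult_le_0_iff)
      ultimately show ?thesis
        using \<open>0 \<le> u\<close> \<open>\<not> 0 \<le> u + h\<close>
        by (auto simp: max_def power2_eq_square algebra_simps abs_le_iff not_le)
    next
      assume "\<not> 0 \<le> u" "0 \<le> u + h"
      then have "(u + h)\<^sup>2 \<le> h\<^sup>2"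
        by (intro power_mono) auto
      then show ?thesis
        using \<open>\<not> 0 \<le> u\<close> \<open>0 \<le> u + h\<close> by (auto simp: max_def)
    qed (auto simp: max_def power2_eq_square algebra_simps)
    then have "\<bar>(max (u + h) 0)\<^sup>2 - (max u 0)\<^sup>2 - 2 * max u 0 * h\<bar> / \<bar>h\<bar> \<le> h\<^sup>2 / \<bar>h\<bar>"
      by (rule divide_right_mono) simp
    moreover have "((max (u + h) 0)\<^sup>2 - (max u 0)\<^sup>2) / h - 2 * max u 0
        = ((max (u + h) 0)\<^sup>2 - (max u 0)\<^sup>2 - 2 * max u 0 * h) / h"
      using that by (simp add: diff_divide_distrib)
    moreover have "h\<^sup>2 / \<bar>h\<bar> = \<bar>h\<bar>"
      using that by (auto simp: power2_eq_square abs_if)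
    ultimately show ?thesis
      by simp
  qed
  then have "\<forall>\<^sub>F h in at 0. norm (((max (u + h) 0)\<^sup>2 - (max u 0)\<^sup>2) / h - 2 * max u 0) \<le> \<bar>h\<bar>"
    by (auto simp: eventually_at_filter)
  moreover have "((\<lambda>h::real. \<bar>h\<bar>) \<longlongrightarrow> 0) (at 0)"
    by (auto intro!: tendsto_eq_intros)
  ultimately have "((\<lambda>h. ((max (u + h) 0)\<^sup>2 - (max u 0)\<^sup>2) / h - 2 * max u 0) \<longlongrightarrow> 0) (at 0)"
    by (rule Lim_null_comparison)
  then show ?thesis
    unfolding DERIV_def by (rule LIM_zero_cancel)
qed

locale convex_program =
  fixes f :: "real^'n \<Rightarrow> real" and g :: "real^'n \<Rightarrow> real^'m" and A :: "real^'n^'p" and b :: "real^'p"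
  assumes convex_f: "convex_on UNIV f" and C1_f: "continuously_differentiable f"
    and convex_g: "\<And>i. convex_on UNIV (\<lambda>x. g x $ i)"
    and C1_g: "\<And>i. continuously_differentiable (\<lambda>x. g x $ i)"
begin

abbreviation df where "df \<equiv> gradient f"
abbreviation dg where "dg i \<equiv> gradient (\<lambda>x. g x $ i)"

lemma GDERIV_f: "GDERIV f x :> df x" and GDERIV_g: "GDERIV (\<lambda>x. g x $ i) x :> dg i x"
  using C1_f C1_g by (auto simp: continuously_differentiable_def intro: GDERIV_gradient)

lemma f_above: "f x + df x \<bullet> (y - x) \<le> f y" and g_above: "g x $ i + dg i x \<bullet> (y - x) \<le> g y $ i"
  using convex_on_above_gradient[OF convex_f GDERIV_f]
    convex_on_above_gradient[OF convex_g GDERIV_g] by auto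

lemma transpose_jacobian_g: "transpose (jacobian g (at x)) *v r = (\<Sum>i\<in>UNIV. r $ i *\<^sub>R dg i x)"
  using C1_g by (intro transpose_jacobian_mult) (auto simp: continuously_differentiable_def)

section \<open>KKT points and optimality\<close>

lemma KKT_points_iff:
  "(x, \<nu>, \<xi>) \<in> KKT_points f g A b \<longleftrightarrow>
     df x + \<nu> v* A + (\<Sum>i\<in>UNIV. \<xi> $ i *\<^sub>R dg i x) = 0 \<and> A *v x = b \<and>
     (\<forall>i. g x $ i \<le> 0 \<and> 0 \<le> \<xi> $ i \<and> \<xi> $ i * g x $ i = 0)"
  unfolding KKT_points_def transpose_jacobian_g by (auto simp: less_eq_vec_def)

lemma feasible_iff: "feasible g A b x \<longleftrightarrow> A *v x = b \<and> (\<forall>i. g x $ i \<le> 0)"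
  by (auto simp: feasible_def less_eq_vec_def)

lemma KKT_gradient_inner:
  assumes "(x, \<nu>, \<xi>) \<in> KKT_points f g A b"
  shows "df x \<bullet> v = - (\<nu> \<bullet> (A *v v)) - (\<Sum>i\<in>UNIV. \<xi> $ i * (dg i x \<bullet> v))"
proof -
  have "(df x + \<nu> v* A + (\<Sum>i\<in>UNIV. \<xi> $ i *\<^sub>R dg i x)) \<bullet> v = 0"
    using assms by (simp add: KKT_points_iff)
  then show ?thesis
    by (simp add: inner_add_left inner_sum_left dot_lmul_matrix)
qed

text \<open>By convexity and complementarity each weighted constraint gradient has nonpositive slope
  towards a feasible \<open>y\<close>. Stationarity turns this into a nonnegative slope of
  \<open>f\<close>, and the tangent inequality then excludes a smaller value at
  \<open>y\<close>.\<close>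

lemma KKT_imp_optimal:
  assumes K: "(x, \<nu>, \<xi>) \<in> KKT_points f g A b"
  shows "optimal f g A b x"
  unfolding optimal_def is_arg_min_def
proof (intro conjI notI)
  show "feasible g A b x"
    using K by (simp add: KKT_points_iff feasible_iff)
next
  assume "\<exists>y. feasible g A b y \<and> f y < f x"
  then obtain y where y: "feasible g A b y" "f y < f x"
    by blast
  have "\<xi> $ i * (dg i x \<bullet> (y - x)) \<le> 0" for i
  proof -
    have "\<xi> $ i * (dg i x \<bullet> (y - x)) \<le> \<xi> $ i * (g y $ i - g x $ i)"
      using K g_above[of x i y] by (intro mult_left_mono) (auto simp: KKT_points_iff)
    also have "\<dots> = \<xi> $ i * g y $ i"
      using K by (simp add: KKT_points_iff right_diff_distrib)
    also have "\<dots> \<le> 0"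
      using K y by (simp add: KKT_points_iff feasible_iff mult_nonneg_nonpos)
    finally show ?thesis .
  qed
  then have "(\<Sum>i\<in>UNIV. \<xi> $ i * (dg i x \<bullet> (y - x))) \<le> 0"
    by (rule sum_nonpos)
  moreover have "A *v (y - x) = 0"
    using K y by (simp add: KKT_points_iff feasible_iff matrix_vector_mult_diff_distrib)
  ultimately have "0 \<le> df x \<bullet> (y - x)"
    using KKT_gradient_inner[OF K, of "y - x"] by simp
  then show False
    using f_above[of x y] y by simp
qed

text \<open>Farkas' lemma produces the multipliers; Slater's point makes every direction that is
  feasible to first order a limit of strictly feasible ones.\<close>

lemma optimal_imp_KKT:
  assumes "slater g A b" "optimal f g A b x"
  shows "\<exists>\<nu> \<xi>. (x, \<nu>, \<xi>) \<in> KKT_points f g A b"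
proof -
  obtain s where s: "A *v s = b" "\<And>i. g s $ i < 0"
    using assms(1) by (auto simp: slater_def)
  have x: "A *v x = b" "\<And>i. g x $ i \<le> 0"
    and opt: "\<And>y. A *v y = b \<Longrightarrow> (\<And>i. g y $ i \<le> 0) \<Longrightarrow> f x \<le> f y"
    using assms(2) by (auto simp: optimal_def is_arg_min_def feasible_iff not_less)
  \<comment> \<open>Rows enter with both signs, so that the multiplier of an equality carries no
    sign constraint.\<close>
  define G where "G = range (\<lambda>j. row j A) \<union> range (\<lambda>j. - row j A) \<union> (\<lambda>i. dg i x) ` {i. g x $ i = 0}"
  define C where "C = convex_cone hull G"
  define Q where "Q = {y. \<exists>\<nu> \<xi>. (\<forall>i. 0 \<le> \<xi> $ i \<and> (g x $ i \<noteq> 0 \<longrightarrow> \<xi> $ i = 0)) \<and>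
      y = \<nu> v* A + (\<Sum>i\<in>UNIV. \<xi> $ i *\<^sub>R dg i x)}"
  have "C \<subseteq> Q"
    unfolding C_def
  proof (rule hull_minimal)
    show "convex_cone Q"
      unfolding convex_cone_iff
    proof (intro conjI ballI allI impI)
      show "0 \<in> Q"
        unfolding Q_def by (auto intro!: exI[of _ 0])
    next
      fix y y' assume "y \<in> Q" "y' \<in> Q"
      then obtain \<nu> \<xi> \<nu>' \<xi>' where
        "\<forall>i. 0 \<le> \<xi> $ i \<and> (g x $ i \<noteq> 0 \<longrightarrow> \<xi> $ i = 0)" "y = \<nu> v* A + (\<Sum>i\<in>UNIV. \<xi> $ i *\<^sub>R dg i x)"
        "\<forall>i. 0 \<le> \<xi>' $ i \<and> (g x $ i \<noteq> 0 \<longrightarrow> \<xi>' $ i = 0)" "y' = \<nu>' v* A + (\<Sum>i\<in>UNIV. \<xi>' $ i *\<^sub>R dg i x)"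
        unfolding Q_def by blast
      then show "y + y' \<in> Q"
        unfolding Q_def
        by (auto intro!: exI[of _ "\<nu> + \<nu>'"] exI[of _ "\<xi> + \<xi>'"]
            simp: vector_matrix_left_distrib sum.distrib scaleR_left_distrib)
    next
      fix y and c :: real assume "y \<in> Q" "0 \<le> c"
      then obtain \<nu> \<xi> where
        "\<forall>i. 0 \<le> \<xi> $ i \<and> (g x $ i \<noteq> 0 \<longrightarrow> \<xi> $ i = 0)" "y = \<nu> v* A + (\<Sum>i\<in>UNIV. \<xi> $ i *\<^sub>R dg i x)"
        unfolding Q_def by blast
      then show "c *\<^sub>R y \<in> Q"
        unfolding Q_def using \<open>0 \<le> c\<close>
        by (auto intro!: exI[of _ "c *\<^sub>R \<nu>"] exI[of _ "c *\<^sub>R \<xi>"]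
            simp: scaleR_vector_matrix_assoc scaleR_sum_right scaleR_right_distrib)
    qed
    show "G \<subseteq> Q"
    proof
      fix y assume "y \<in> G"
      then consider j where "y = row j A" | j where "y = - row j A"
        | i where "g x $ i = 0" "y = dg i x"
        by (auto simp: G_def)
      then show "y \<in> Q"
      proof cases
        case 1
        then show ?thesis
          unfolding Q_def by (intro CollectI exI[of _ "axis j 1"] exI[of _ 0])
            (simp add: axis_vector_matrix_mult)
      next
        case 2
        have "(- axis j 1) v* A = - row j A"
          using scaleR_vector_matrix_assoc[of "- 1" "axis j 1" A]
          by (simp add: axis_vector_matrix_mult)
        then show ?thesis
          unfolding Q_def using 2
          by (intro CollectI exI[of _ "- axis j 1"] exI[of _ 0]) simp
      next
        case 3
        have "(\<Sum>k\<in>UNIV. axis i 1 $ k *\<^sub>R dg k x) = (\<Sum>k\<in>UNIV. if k = i then dg k x else 0)"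
          by (intro sum.cong) (auto simp: axis_def)
        then have "y = 0 v* A + (\<Sum>k\<in>UNIV. axis i 1 $ k *\<^sub>R dg k x)"
          using 3 by simp
        then show ?thesis
          unfolding Q_def using 3(1)
          by - (rule CollectI, rule exI[of _ 0], rule exI[of _ "axis i 1"], simp add: axis_def)
      qed
    qed
  qed
  have "- df x \<in> C"
  proof (rule ccontr)
    assume "- df x \<notin> C"
    moreover have "convex C"
      unfolding C_def by (rule convex_convex_cone_hull)
    \<comment> \<open>Finite generation makes the cone closed, on which the strict separation
      relies.\<close>
    moreover have "closed C"
      unfolding C_def G_def by (rule closed_convex_cone_hull) simp
    ultimately obtain a \<beta> where a: "a \<bullet> (- df x) < \<beta>" "\<And>c. c \<in> C \<Longrightarrow> \<beta> < a \<bullet> c"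
      using separating_hyperplane_closed_point[of C "- df x"] by metis
    have "\<beta> < 0"
      using a(2)[of 0] convex_cone_hull_contains_0 by (auto simp: C_def)
    have nonneg: "0 \<le> a \<bullet> c" if "c \<in> G" for c
    proof (rule ccontr)
      assume neg: "\<not> 0 \<le> a \<bullet> c"
      \<comment> \<open>The factor is positive because both numbers are negative. The scaled
        generator has inner product exactly \<open>\<beta>\<close> with \<open>a\<close>, which
        strict separation forbids.\<close>
      have "(\<beta> / (a \<bullet> c)) *\<^sub>R c \<in> C"
        unfolding C_def using that neg \<open>\<beta> < 0\<close>
        by (intro convex_cone_hull_mul hull_inc) (auto simp: divide_nonpos_neg)
      then show False
        using a(2) neg by fastforce
    qed
    \<comment> \<open>\<open>- a\<close> decreases \<open>f\<close> but keeps active constraints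
      only to first order; a small multiple of the direction \<open>d\<close> towards the Slater
      point makes them strictly decrease. The factor \<open>m\<close> spends at most half of the
      descent \<open>a \<bullet> df x\<close> on this, and the \<open>1\<close> in \<open>q\<close>
      keeps the denominator positive.\<close>
    define d where "d = s - x"
    define q where "q = \<bar>df x \<bullet> d\<bar> + 1"
    define m where "m = (a \<bullet> df x) / (2 * q)"
    have "0 < q"
      unfolding q_def by linarith
    have "0 < a \<bullet> df x"
      using a(1) \<open>\<beta> < 0\<close> by simp
    then have "0 < m"
      using \<open>0 < q\<close> by (simp add: m_def)
    define w where "w = m *\<^sub>R d - a"
    have "m * (df x \<bullet> d) \<le> m * q"
      using \<open>0 < m\<close> by (intro mult_left_mono) (auto simp: q_def)
    also have "\<dots> = (a \<bullet> df x) / 2"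
      using \<open>0 < q\<close> by (simp add: m_def)
    finally have w_f: "w \<bullet> df x < 0"
      using \<open>0 < a \<bullet> df x\<close> by (simp add: w_def inner_diff_left inner_commute[of d])
    have "row j A \<bullet> a = 0" for j
      using nonneg[of "row j A"] nonneg[of "- row j A"] by (auto simp: G_def inner_commute)
    then have "A *v a = 0"
      by (simp add: vec_eq_iff matrix_vector_mul_component row_def)
    then have w_A: "A *v w = 0"
      using s(1) x(1) by (simp add: w_def d_def matrix_vector_mult_diff_distrib matrix_vector_mult_scaleR)
    have w_g: "w \<bullet> dg i x < 0" if "g x $ i = 0" for i
    proof -
      have "dg i x \<bullet> d < 0"
        using g_above[of x i s] s(2)[of i] that by (simp add: d_def)
      moreover have "0 \<le> a \<bullet> dg i x"
        using that by (intro nonneg) (auto simp: G_def)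
      ultimately show ?thesis
        using \<open>0 < m\<close> mult_pos_neg[of m "dg i x \<bullet> d"]
        by (simp add: w_def inner_diff_left inner_commute[of d])
    qed
    have "\<forall>\<^sub>F t in at_right 0. g (x + t *\<^sub>R w) $ i \<le> 0" for i
    proof (cases "g x $ i = 0")
      case True
      from eventually_decrease_along_line[OF GDERIV_g w_g[OF True]] show ?thesis
        by eventually_elim (use True in auto)
    next
      case False
      then have "g x $ i < 0"
        using x(2)[of i] by simp
      moreover have "isCont (\<lambda>t. g (x + t *\<^sub>R w) $ i) 0"
        by (rule DERIV_isCont[OF has_field_derivative_along_line[OF GDERIV_g]])
      then have "((\<lambda>t. g (x + t *\<^sub>R w) $ i) \<longlongrightarrow> g (x + 0 *\<^sub>R w) $ i) (at_right 0)"
        unfolding isCont_def by (rule tendsto_mono[OF at_le[OF subset_UNIV]])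
      ultimately have "\<forall>\<^sub>F t in at_right 0. g (x + t *\<^sub>R w) $ i < 0"
        by (simp add: order_tendstoD)
      then show ?thesis
        by eventually_elim simp
    qed
    then have "\<forall>\<^sub>F t in at_right 0. \<forall>i. g (x + t *\<^sub>R w) $ i \<le> 0"
      by (rule eventually_all_finite)
    then have "\<forall>\<^sub>F t in at_right 0. (\<forall>i. g (x + t *\<^sub>R w) $ i \<le> 0) \<and> f (x + t *\<^sub>R w) < f x"
      using eventually_decrease_along_line[OF GDERIV_f w_f] by eventually_elim auto
    then have "\<exists>t::real. (\<forall>i. g (x + t *\<^sub>R w) $ i \<le> 0) \<and> f (x + t *\<^sub>R w) < f x"
      by (rule eventually_happens'[OF trivial_limit_at_right_real])
    then obtain t :: real where "\<And>i. g (x + t *\<^sub>R w) $ i \<le> 0" "f (x + t *\<^sub>R w) < f x"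
      by blast
    moreover have "A *v (x + t *\<^sub>R w) = b"
      using x(1) w_A by (simp add: matrix_vector_right_distrib matrix_vector_mult_scaleR)
    ultimately show False
      using opt[of "x + t *\<^sub>R w"] by (meson not_less)
  qed
  then have "- df x \<in> Q"
    using \<open>C \<subseteq> Q\<close> by (rule rev_subsetD)
  then obtain \<nu> \<xi> where \<xi>: "\<forall>i. 0 \<le> \<xi> $ i \<and> (g x $ i \<noteq> 0 \<longrightarrow> \<xi> $ i = 0)"
    and eq: "- df x = \<nu> v* A + (\<Sum>i\<in>UNIV. \<xi> $ i *\<^sub>R dg i x)"
    unfolding Q_def by blast
  have "df x + \<nu> v* A + (\<Sum>i\<in>UNIV. \<xi> $ i *\<^sub>R dg i x) = 0"
    unfolding add.assoc eq[symmetric] by simp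
  then have "(x, \<nu>, \<xi>) \<in> KKT_points f g A b"
    unfolding KKT_points_iff using x \<xi> by (metis mult_eq_0_iff)
  then show ?thesis
    by blast
qed

text \<open>Subtracting the two stationarity equations cancels \<open>df x\<close> and leaves a
  vanishing combination of constraint gradients. Complementarity removes the inactive ones, so only
  the family in \<open>LICQ\<close> remains.\<close>

lemma LICQ_unique_multipliers:
  assumes "LICQ g A x" "(x, \<nu>, \<xi>) \<in> KKT_points f g A b" "(x, \<nu>', \<xi>') \<in> KKT_points f g A b"
  shows "\<nu> = \<nu>' \<and> \<xi> = \<xi>'"
proof -
  define I where "I = (UNIV :: 'p set) <+> {i. g x $ i = 0}"
  define v where "v = constraint_gradient g A x"
  define c where "c = case_sum (\<lambda>j. \<nu> $ j - \<nu>' $ j) (\<lambda>i. \<xi> $ i - \<xi>' $ i)"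
  have inj: "inj_on v I" and ind: "independent (v ` I)"
    using assms(1) by (auto simp: LICQ_def I_def v_def Let_def)
  have fin: "finite I"
    by (simp add: I_def)
  have zero: "\<xi> $ i = 0 \<and> \<xi>' $ i = 0" if "g x $ i \<noteq> 0" for i
    using assms that by (auto simp: KKT_points_iff)
  have "(\<Sum>k\<in>I. c k *\<^sub>R v k)
      = (\<Sum>j\<in>UNIV. (\<nu> $ j - \<nu>' $ j) *\<^sub>R row j A) + (\<Sum>i | g x $ i = 0. (\<xi> $ i - \<xi>' $ i) *\<^sub>R dg i x)"
    unfolding I_def by (subst sum.Plus) (auto simp: c_def v_def constraint_gradient_def)
  also have "(\<Sum>i | g x $ i = 0. (\<xi> $ i - \<xi>' $ i) *\<^sub>R dg i x)
      = (\<Sum>i\<in>UNIV. (\<xi> $ i - \<xi>' $ i) *\<^sub>R dg i x)"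
    by (rule sum.mono_neutral_left) (auto simp: zero)
  also have "(\<Sum>j\<in>UNIV. (\<nu> $ j - \<nu>' $ j) *\<^sub>R row j A) + (\<Sum>i\<in>UNIV. (\<xi> $ i - \<xi>' $ i) *\<^sub>R dg i x)
      = (df x + \<nu> v* A + (\<Sum>i\<in>UNIV. \<xi> $ i *\<^sub>R dg i x))
        - (df x + \<nu>' v* A + (\<Sum>i\<in>UNIV. \<xi>' $ i *\<^sub>R dg i x))"
    by (simp add: vector_matrix_mult_rows scaleR_left_diff_distrib sum_subtractf)
  also have "\<dots> = 0"
    using assms by (simp add: KKT_points_iff)
  finally have "(\<Sum>k\<in>I. c k *\<^sub>R v k) = 0" .
  \<comment> \<open>\<open>independent\<close> speaks of a set of vectors, so the sum over indices
    is carried to the image of \<open>v\<close>; injectivity keeps the coefficients apart.\<close>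
  then have "(\<Sum>w\<in>v ` I. c (the_inv_into I v w) *\<^sub>R w) = 0"
    by (subst sum.reindex[OF inj]) (simp add: the_inv_into_f_f[OF inj])
  then have "c (the_inv_into I v w) = 0" if "w \<in> v ` I" for w
    using independentD[OF ind finite_imageI[OF fin] subset_refl _ that,
        of "\<lambda>w. c (the_inv_into I v w)"] by blast
  then have c0: "c k = 0" if "k \<in> I" for k
    using that the_inv_into_f_f[OF inj] by (metis imageI)
  have "\<nu> $ j = \<nu>' $ j" for j
    using c0[of "Inl j"] by (simp add: I_def c_def Plus_def)
  moreover have "\<xi> $ i = \<xi>' $ i" for i
    using c0[of "Inr i"] zero[of i] by (cases "g x $ i = 0") (auto simp: I_def c_def Plus_def)
  ultimately show ?thesis
    by (simp add: vec_eq_iff)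
qed

lemma strictly_convex_unique_optimal:
  assumes "strictly_convex f" "optimal f g A b x" "optimal f g A b y"
  shows "x = y"
proof (rule ccontr)
  assume "x \<noteq> y"
  define w where "w = (1 - 1/2) *\<^sub>R x + (1/2) *\<^sub>R y"
  have fx: "feasible g A b x" and fy: "feasible g A b y"
    using assms by (auto simp: optimal_def is_arg_min_def)
  have "A *v w = (1 - 1/2) *\<^sub>R b + (1/2) *\<^sub>R b"
    using fx fy by (simp add: feasible_iff w_def matrix_vector_right_distrib matrix_vector_mult_scaleR)
  then have "A *v w = b"
    by (simp flip: scaleR_left_distrib)
  moreover have "g w $ i \<le> 0" for i
  proof -
    have "g w $ i \<le> (1 - 1/2) * g x $ i + (1/2) * g y $ i"
      unfolding w_def by (rule convex_onD[OF convex_g]) auto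
    moreover have "g x $ i \<le> 0" "g y $ i \<le> 0"
      using fx fy by (auto simp: feasible_iff)
    ultimately show ?thesis
      by simp
  qed
  ultimately have "feasible g A b w"
    by (simp add: feasible_iff)
  then have "f x \<le> f w" "f y \<le> f w"
    using assms by (auto simp: optimal_def is_arg_min_def not_less)
  moreover have "f w < (1 - 1/2) * f x + (1/2) * f y"
    unfolding w_def using \<open>x \<noteq> y\<close>
    by (intro assms(1)[unfolded strictly_convex_def, rule_format]) auto
  ultimately show False
    by simp
qed

lemma unique_KKT_point:
  assumes "slater g A b" "strictly_convex f" "optimal f g A b x" "LICQ g A x"
  shows "\<exists>\<nu> \<xi>. KKT_points f g A b = {(x, \<nu>, \<xi>)}"
proof -
  obtain \<nu> \<xi> where K: "(x, \<nu>, \<xi>) \<in> KKT_points f g A b"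
    using optimal_imp_KKT assms by blast
  moreover have "z = (x, \<nu>, \<xi>)" if "z \<in> KKT_points f g A b" for z
  proof -
    obtain x' \<nu>' \<xi>' where z: "z = (x', \<nu>', \<xi>')"
      by (cases z)
    then have "x' = x"
      using KKT_imp_optimal strictly_convex_unique_optimal assms that by blast
    then show ?thesis
      using LICQ_unique_multipliers assms(4) K that z by blast
  qed
  ultimately show ?thesis
    by blast
qed

end

section \<open>The augmented Lagrangian and the Lyapunov function\<close>

locale sppid = convex_program f g A b
  for f :: "real^'n \<Rightarrow> real" and g :: "real^'n \<Rightarrow> real^'m" and A :: "real^'n^'p" and b :: "real^'p" +
  fixes kd kp ki kpi kii :: real
  assumes gains: "0 \<le> kd" "0 < kp" "0 < ki" "0 < kpi" "0 < kii"
begin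

section \<open>Preconditioner and multiplier update\<close>

definition M :: "real^'n^'n" where "M = mat 1 + kd *\<^sub>R (transpose A ** A)"

text \<open>The multiplier update of the method of multipliers: the weight that the augmented
  Lagrangian gives to \<open>dg i x\<close> in its \<open>x\<close>-gradient.\<close>

definition res :: "real^'n \<Rightarrow> real^'m \<Rightarrow> real^'m" where
  "res x \<xi> = ReLU (\<xi> + kpi *\<^sub>R g x)"

text \<open>The partial gradient of \<open>aug_lagrangian\<close> in \<open>x\<close>; the penalty
  on the equalities appears as a shift of \<open>\<nu>\<close>.\<close>

definition grad_L :: "real^'n \<Rightarrow> real^'p \<Rightarrow> real^'m \<Rightarrow> real^'n" where
  "grad_L x \<nu> \<xi> = df x + (\<nu> + kp *\<^sub>R (A *v x - b)) v* A + (\<Sum>i\<in>UNIV. res x \<xi> $ i *\<^sub>R dg i x)"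

abbreviation F where "F \<equiv> sppid_field f g A b kd kp ki kpi kii"

lemma F_eq: "F (x, \<nu>, \<xi>) =
    (- (matrix_inv M *v grad_L x \<nu> \<xi>), ki *\<^sub>R (A *v x - b), kii *\<^sub>R (res x \<xi> - \<xi>))"
  unfolding sppid_field_def grad_L_def M_def res_def
  by (simp add: Let_def transpose_jacobian_g[unfolded transpose_matrix_vector] scaleR_right_diff_distrib)

lemma res_component: "res x \<xi> $ i = max (\<xi> $ i + kpi * g x $ i) 0"
  by (simp add: res_def ReLU_def)

lemma M_inner: "(M *v u) \<bullet> v = u \<bullet> v + kd * ((A *v u) \<bullet> (A *v v))"
proof -
  have "((A *v u) v* A) \<bullet> v = (A *v u) \<bullet> (A *v v)"
    by (rule dot_lmul_matrix)
  then show ?thesis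
    by (simp add: M_def matrix_vector_mult_add_rdistrib inner_add_left
        matrix_vector_mul_assoc[symmetric] flip: scaleR_matrix_vector_assoc)
qed

lemma M_inner_commute: "(M *v u) \<bullet> v = u \<bullet> (M *v v)"
  by (simp add: M_inner inner_commute[of u "M *v v"]) (simp add: inner_commute)

lemma M_inner_self: "(M *v u) \<bullet> u \<ge> u \<bullet> u"
  using gains by (simp add: M_inner)

lemma M_matrix_inv: "M *v (matrix_inv M *v q) = q"
proof -
  have "u = 0" if "M *v u = 0" for u
    using M_inner_self[of u] inner_ge_zero[of u] that by (simp add: order_antisym_conv)
  then have "invertible M"
    unfolding invertible_left_inverse matrix_left_invertible_ker by blast
  then have "M ** matrix_inv M = mat 1"
    unfolding invertible_def matrix_inv_def by (rule someI2_ex) simp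
  then show ?thesis
    by (metis matrix_vector_mul_assoc matrix_vector_mul_lid)
qed

section \<open>Continuity of the vector field\<close>

lemma continuous_on_df: "continuous_on S df" and continuous_on_dg: "continuous_on S (dg i)"
  using C1_f C1_g by (auto simp: continuously_differentiable_def intro: continuous_on_subset)

lemma continuous_on_f: "continuous_on S f"
proof -
  have "isCont f x" for x
    using GDERIV_f[of x] unfolding gderiv_def by (rule has_derivative_continuous)
  then show ?thesis
    by (simp add: continuous_at_imp_continuous_on)
qed

lemma continuous_on_g_component: "continuous_on S (\<lambda>x. g x $ i)"
proof -
  have "isCont (\<lambda>x. g x $ i) x" for x
    using GDERIV_g[of i x] unfolding gderiv_def by (rule has_derivative_continuous)
  then show ?thesis
    by (simp add: continuous_at_imp_continuous_on)
qed

lemma continuous_on_matrix_vector_mult: "continuous_on S h \<Longrightarrow> continuous_on S (\<lambda>z. B *v h z)"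
  for B :: "real^'k^'l"
  by (rule bounded_linear.continuous_on[OF matrix_vector_mul_bounded_linear])

lemmas program_continuous =
  continuous_on_compose2[OF continuous_on_f _ subset_UNIV]
  continuous_on_compose2[OF continuous_on_df _ subset_UNIV]
  continuous_on_compose2[OF continuous_on_dg _ subset_UNIV]
  continuous_on_compose2[OF continuous_on_g_component _ subset_UNIV]
  continuous_on_matrix_vector_mult

lemma continuous_on_res:
  assumes "continuous_on S x" "continuous_on S \<xi>"
  shows "continuous_on S (\<lambda>z. res (x z) (\<xi> z))"
proof -
  have "res x \<xi> = (\<chi> i. max (\<xi> $ i + kpi * g x $ i) 0)" for x \<xi>
    by (simp add: vec_eq_iff res_component)
  then show ?thesis
    using assms by (auto intro!: continuous_intros program_continuous)
qed

lemma continuous_on_grad_L: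
  assumes "continuous_on S x" "continuous_on S \<nu>" "continuous_on S \<xi>"
  shows "continuous_on S (\<lambda>z. grad_L (x z) (\<nu> z) (\<xi> z))"
  unfolding grad_L_def transpose_matrix_vector[symmetric]
  using assms by (intro continuous_intros program_continuous continuous_on_res)

lemma continuous_on_F: "continuous_on S F"
proof -
  have "F = (\<lambda>z. (- (matrix_inv M *v grad_L (fst z) (fst (snd z)) (snd (snd z))),
      ki *\<^sub>R (A *v fst z - b), kii *\<^sub>R (res (fst z) (snd (snd z)) - snd (snd z))))"
    by (auto simp: fun_eq_iff F_eq)
  then show ?thesis
    by (simp only:) (intro continuous_intros program_continuous continuous_on_res continuous_on_grad_L)
qed

text \<open>Since \<open>kpi > 0\<close>, the scalar equation \<open>max (u + kpi * v) 0 = u\<close>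
  takes either the first branch, so \<open>v = 0\<close>, or the second, so \<open>u = 0\<close> and
  \<open>v \<le> 0\<close>. Complementarity is thus the rest condition of the \<open>\<xi>\<close>
  equation.\<close>

lemma res_fixpoint_iff:
  "res x \<xi> = \<xi> \<longleftrightarrow> (\<forall>i. g x $ i \<le> 0 \<and> 0 \<le> \<xi> $ i \<and> \<xi> $ i * g x $ i = 0)"
proof -
  have "max (u + kpi * v) 0 = u \<longleftrightarrow> v \<le> 0 \<and> 0 \<le> u \<and> u * v = 0" for u v :: real
    using gains by (auto simp: max_def mult_le_0_iff zero_le_mult_iff)
  then show ?thesis
    by (simp add: vec_eq_iff res_component)
qed

lemma KKT_points_alt:
  "(x, \<nu>, \<xi>) \<in> KKT_points f g A b \<longleftrightarrow> grad_L x \<nu> \<xi> = 0 \<and> A *v x = b \<and> res x \<xi> = \<xi>"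
  unfolding KKT_points_iff grad_L_def res_fixpoint_iff[symmetric] by auto

lemma KKT_imp_F_eq_0:
  assumes "z \<in> KKT_points f g A b"
  shows "F z = 0"
  using assms by (cases z) (auto simp: KKT_points_alt F_eq zero_prod_def)

text \<open>The weights undo the preconditioning: the field is \<open>- matrix_inv M\<close> applied
  to the \<open>x\<close>-gradient of \<open>aug_lagrangian\<close>, \<open>ki\<close> times its
  \<open>\<nu>\<close>-gradient and \<open>kii * kpi\<close> times its
  \<open>\<xi>\<close>-gradient.\<close>

definition lyapunov ::
  "(real^'n) \<times> (real^'p) \<times> (real^'m) \<Rightarrow> (real^'n) \<times> (real^'p) \<times> (real^'m) \<Rightarrow> real"
  where
  "lyapunov = (\<lambda>(xs, \<nu>s, \<xi>s) (x, \<nu>, \<xi>).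
     (M *v (x - xs)) \<bullet> (x - xs) + (\<nu> - \<nu>s) \<bullet> (\<nu> - \<nu>s) / ki + (\<xi> - \<xi>s) \<bullet> (\<xi> - \<xi>s) / (kii * kpi))"

text \<open>The saddle operator of \<open>aug_lagrangian\<close>, that is its
  \<open>x\<close>-gradient and the negated multiplier gradients, paired with the displacement from
  the reference point. The operator vanishes at KKT points, so nonnegativity there is an instance of
  its monotonicity.\<close>

definition dissipation ::
  "(real^'n) \<times> (real^'p) \<times> (real^'m) \<Rightarrow> (real^'n) \<times> (real^'p) \<times> (real^'m) \<Rightarrow> real"
  where
  "dissipation = (\<lambda>(xs, \<nu>s, \<xi>s) (x, \<nu>, \<xi>).
     grad_L x \<nu> \<xi> \<bullet> (x - xs) - (\<nu> - \<nu>s) \<bullet> (A *v x - b) - (res x \<xi> - \<xi>) \<bullet> (\<xi> - \<xi>s) / kpi)"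

text \<open>Rockafellar's form for inequalities: the squared hinge is what remains after minimising
  the multiplier and penalty terms over nonnegative slacks. Its \<open>\<xi>\<close>-gradient is
  \<open>(res x \<xi> - \<xi>) / kpi\<close>.\<close>

definition aug_lagrangian :: "(real^'n) \<times> (real^'p) \<times> (real^'m) \<Rightarrow> real" where
  "aug_lagrangian = (\<lambda>(x, \<nu>, \<xi>). f x + \<nu> \<bullet> (A *v x - b) + kp / 2 * ((A *v x - b) \<bullet> (A *v x - b))
     + (\<Sum>i\<in>UNIV. (max (\<xi> $ i + kpi * g x $ i) 0)\<^sup>2 - (\<xi> $ i)\<^sup>2) / (2 * kpi))"

text \<open>Descent in \<open>x\<close> enters negatively and ascent in the multipliers positively,
  so there is no fixed sign. The last two terms vanish wherever the dissipation relative to a KKT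
  point does.\<close>

definition aug_lagrangian_rate :: "(real^'n) \<times> (real^'p) \<times> (real^'m) \<Rightarrow> real" where
  "aug_lagrangian_rate = (\<lambda>(x, \<nu>, \<xi>). grad_L x \<nu> \<xi> \<bullet> fst (F (x, \<nu>, \<xi>)) + ki * ((A *v x - b) \<bullet> (A *v x - b))
     + kii / kpi * ((res x \<xi> - \<xi>) \<bullet> (res x \<xi> - \<xi>)))"

lemma continuous_on_lyapunov: "continuous_on S (lyapunov zs)"
  unfolding lyapunov_def case_prod_beta' by (intro continuous_intros program_continuous) (use gains in auto)

lemma continuous_on_dissipation: "continuous_on S (dissipation zs)"
  unfolding dissipation_def case_prod_beta'
  by (intro continuous_intros program_continuous continuous_on_res continuous_on_grad_L)
    (use gains in auto)

lemma continuous_on_aug_lagrangian: "continuous_on S aug_lagrangian"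
  unfolding aug_lagrangian_def case_prod_beta'
  by (intro continuous_intros program_continuous) (use gains in auto)

lemma continuous_on_aug_lagrangian_rate: "continuous_on S aug_lagrangian_rate"
  unfolding aug_lagrangian_rate_def case_prod_beta'
  by (intro continuous_intros program_continuous continuous_on_res continuous_on_grad_L
      continuous_on_compose2[OF continuous_on_F _ subset_UNIV]) (use gains in auto)

lemma lyapunov_lower:
  obtains c where "0 < c" "\<And>zs z. c * (norm (z - zs))\<^sup>2 \<le> lyapunov zs z"
proof -
  define c where "c = min 1 (min (1 / ki) (1 / (kii * kpi)))"
  have c: "0 < c" "c \<le> 1" "c \<le> 1 / ki" "c \<le> 1 / (kii * kpi)"
    using gains by (auto simp: c_def)
  have "c * (norm (z - zs))\<^sup>2 \<le> lyapunov zs z" for z zs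
  proof -
    obtain x \<nu> \<xi> xs \<nu>s \<xi>s where z: "z = (x, \<nu>, \<xi>)" "zs = (xs, \<nu>s, \<xi>s)"
      by (metis prod_cases3)
    have "c * ((x - xs) \<bullet> (x - xs)) \<le> (M *v (x - xs)) \<bullet> (x - xs)"
      using M_inner_self[of "x - xs"] mult_right_mono[OF c(2), of "(x - xs) \<bullet> (x - xs)"] by simp
    moreover have "c * ((\<nu> - \<nu>s) \<bullet> (\<nu> - \<nu>s)) \<le> (\<nu> - \<nu>s) \<bullet> (\<nu> - \<nu>s) / ki"
      using mult_right_mono[OF c(3), of "(\<nu> - \<nu>s) \<bullet> (\<nu> - \<nu>s)"] by simp
    moreover have "c * ((\<xi> - \<xi>s) \<bullet> (\<xi> - \<xi>s)) \<le> (\<xi> - \<xi>s) \<bullet> (\<xi> - \<xi>s) / (kii * kpi)"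
      using mult_right_mono[OF c(4), of "(\<xi> - \<xi>s) \<bullet> (\<xi> - \<xi>s)"] by simp
    moreover have "(norm (z - zs))\<^sup>2
        = (x - xs) \<bullet> (x - xs) + (\<nu> - \<nu>s) \<bullet> (\<nu> - \<nu>s) + (\<xi> - \<xi>s) \<bullet> (\<xi> - \<xi>s)"
      by (simp add: z power2_norm_eq_inner)
    ultimately show ?thesis
      unfolding lyapunov_def z by (simp add: distrib_left)
  qed
  then show thesis
    using that c(1) by blast
qed

lemma lyapunov_self: "lyapunov z z = 0"
  by (cases z) (simp add: lyapunov_def)

text \<open>This form lets the sign be read off term by term: monotonicity of \<open>df\<close>, the
  equality penalty, and for each constraint two convexity gaps, a square, and a multiplier times the
  part cut off by \<open>max\<close>.\<close>

lemma dissipation_decomposition: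
  assumes K: "(xs, \<nu>s, \<xi>s) \<in> KKT_points f g A b"
  shows "dissipation (xs, \<nu>s, \<xi>s) (x, \<nu>, \<xi>) =
      (df x - df xs) \<bullet> (x - xs) + kp * ((A *v x - b) \<bullet> (A *v x - b))
      + (\<Sum>i\<in>UNIV. \<xi>s $ i * (g x $ i - dg i xs \<bullet> (x - xs))
          + res x \<xi> $ i * (dg i x \<bullet> (x - xs) - g x $ i)
          + (res x \<xi> $ i - \<xi> $ i)\<^sup>2 / kpi
          + \<xi>s $ i * (res x \<xi> $ i - (\<xi> $ i + kpi * g x $ i)) / kpi)"
proof -
  have Ax: "A *v (x - xs) = A *v x - b"
    using K by (simp add: KKT_points_alt matrix_vector_mult_diff_distrib)
  have eq: "r * p - \<xi>si * q - (r - \<xi>i) * (\<xi>i - \<xi>si) / kpi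
      = \<xi>si * (gi - q) + r * (p - gi) + (r - \<xi>i)\<^sup>2 / kpi + \<xi>si * (r - (\<xi>i + kpi * gi)) / kpi"
    if "r = max (\<xi>i + kpi * gi) 0" for r p q gi \<xi>i \<xi>si
  proof -
    have cancel: "kpi * (y / kpi) = y" for y
      using gains by simp
    \<comment> \<open>\<open>r\<close> is either \<open>0\<close> or
      \<open>\<xi>i + kpi * gi\<close>; the identity uses the maximum only through this
      product.\<close>
    have "r * (r - (\<xi>i + kpi * gi)) = 0"
      using that by (auto simp: max_def)
    then have "kpi * (r * gi) = r * (r - \<xi>i)"
      by (simp add: algebra_simps)
    then have "kpi * r * p - kpi * \<xi>si * q - (r - \<xi>i) * (\<xi>i - \<xi>si)
        = kpi * \<xi>si * (gi - q) + kpi * r * (p - gi) + (r - \<xi>i)\<^sup>2 + \<xi>si * (r - (\<xi>i + kpi * gi))"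
      by algebra
    then have "kpi * (r * p - \<xi>si * q - (r - \<xi>i) * (\<xi>i - \<xi>si) / kpi)
        = kpi * (\<xi>si * (gi - q) + r * (p - gi) + (r - \<xi>i)\<^sup>2 / kpi + \<xi>si * (r - (\<xi>i + kpi * gi)) / kpi)"
      by (simp only: right_diff_distrib[of kpi] distrib_left[of kpi] cancel mult.assoc)
    then show ?thesis
      using gains by (subst (asm) mult_left_cancel) auto
  qed
  have "dissipation (xs, \<nu>s, \<xi>s) (x, \<nu>, \<xi>) = df x \<bullet> (x - xs) + \<nu>s \<bullet> (A *v x - b) + kp * ((A *v x - b) \<bullet> (A *v x - b))
      + (\<Sum>i\<in>UNIV. res x \<xi> $ i * (dg i x \<bullet> (x - xs)))
      - (\<Sum>i\<in>UNIV. (res x \<xi> $ i - \<xi> $ i) * (\<xi> $ i - \<xi>s $ i) / kpi)"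
    unfolding dissipation_def grad_L_def
    by (simp add: inner_add_left inner_diff_left inner_sum_left dot_lmul_matrix Ax)
      (simp add: inner_vec_def left_diff_distrib sum_subtractf diff_divide_distrib sum_divide_distrib)
  \<comment> \<open>Stationarity at the KKT point trades
    \<open>\<nu>s \<bullet> (A *v x - b)\<close> for gradient terms at \<open>xs\<close>.\<close>
  also have "\<dots> = (df x - df xs) \<bullet> (x - xs) + kp * ((A *v x - b) \<bullet> (A *v x - b))
      + (\<Sum>i\<in>UNIV. res x \<xi> $ i * (dg i x \<bullet> (x - xs)) - \<xi>s $ i * (dg i xs \<bullet> (x - xs))
          - (res x \<xi> $ i - \<xi> $ i) * (\<xi> $ i - \<xi>s $ i) / kpi)"
    using KKT_gradient_inner[OF K, of "x - xs"]
    by (simp add: Ax inner_diff_left sum_subtractf)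
  finally show ?thesis
    by (simp only: eq[OF res_component])
qed

section \<open>Sign and zeros of the dissipation\<close>

lemma gradient_monotone: "0 \<le> (df x - df xs) \<bullet> (x - xs)"
  using f_above[of x xs] f_above[of xs x] by (simp add: inner_diff_left inner_diff_right)

text \<open>All terms of the decomposition are nonnegative, so a vanishing sum makes each of them
  vanish. The penalty and the squares then give \<open>A *v x = b\<close> and
  \<open>res x \<xi> = \<xi>\<close>; the equality of the values of \<open>f\<close> comes from the
  convexity terms.\<close>

lemma
  assumes K: "(xs, \<nu>s, \<xi>s) \<in> KKT_points f g A b"
  shows dissipation_nonneg: "0 \<le> dissipation (xs, \<nu>s, \<xi>s) (x, \<nu>, \<xi>)"
    and dissipation_eq_0: "dissipation (xs, \<nu>s, \<xi>s) (x, \<nu>, \<xi>) = 0 \<Longrightarrow> A *v x = b \<and> res x \<xi> = \<xi> \<and> f x = f xs"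
proof -
  define a1 where "a1 i = \<xi>s $ i * (g x $ i - dg i xs \<bullet> (x - xs))" for i
  define a2 where "a2 i = res x \<xi> $ i * (dg i x \<bullet> (x - xs) - g x $ i)" for i
  define a3 where "a3 i = (res x \<xi> $ i - \<xi> $ i)\<^sup>2 / kpi" for i
  define a4 where "a4 i = \<xi>s $ i * (res x \<xi> $ i - (\<xi> $ i + kpi * g x $ i)) / kpi" for i
  have Ks: "A *v xs = b" "g xs $ i \<le> 0" "0 \<le> \<xi>s $ i" "\<xi>s $ i * g xs $ i = 0" for i
    using K by (auto simp: KKT_points_iff)
  have dissipation: "dissipation (xs, \<nu>s, \<xi>s) (x, \<nu>, \<xi>) = (df x - df xs) \<bullet> (x - xs) + kp * ((A *v x - b) \<bullet> (A *v x - b))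
      + (\<Sum>i\<in>UNIV. a1 i + a2 i + a3 i + a4 i)"
    unfolding dissipation_decomposition[OF K] a1_def a2_def a3_def a4_def ..
  have a1: "0 \<le> a1 i" for i
  proof -
    have "a1 i = \<xi>s $ i * (g x $ i - (g xs $ i + dg i xs \<bullet> (x - xs)))"
      using Ks(4)[of i] by (simp add: a1_def algebra_simps)
    then show ?thesis
      using Ks(3)[of i] g_above[of xs i x] by simp
  qed
  have a2: "0 \<le> a2 i" for i
  proof -
    have "0 \<le> dg i x \<bullet> (x - xs) - g x $ i"
      using Ks(2)[of i] g_above[of x i xs] by (simp add: inner_diff_right)
    then show ?thesis
      by (simp add: a2_def res_component)
  qed
  have a3: "0 \<le> a3 i" and a4: "0 \<le> a4 i" for i
    using gains Ks(3)[of i] by (auto simp: a3_def a4_def res_component)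
  have quad: "0 \<le> kp * ((A *v x - b) \<bullet> (A *v x - b))"
    using gains by simp
  have sum: "0 \<le> (\<Sum>i\<in>UNIV. a1 i + a2 i + a3 i + a4 i)"
    using a1 a2 a3 a4 by (intro sum_nonneg) (simp add: add_nonneg_nonneg)
  show "0 \<le> dissipation (xs, \<nu>s, \<xi>s) (x, \<nu>, \<xi>)"
    unfolding dissipation using gradient_monotone[of x xs] quad sum by linarith
  assume "dissipation (xs, \<nu>s, \<xi>s) (x, \<nu>, \<xi>) = 0"
  then have z: "(df x - df xs) \<bullet> (x - xs) = 0" "kp * ((A *v x - b) \<bullet> (A *v x - b)) = 0"
    "(\<Sum>i\<in>UNIV. a1 i + a2 i + a3 i + a4 i) = 0"
    unfolding dissipation using gradient_monotone[of x xs] quad sum by linarith+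
  have "a1 i + a2 i + a3 i + a4 i = 0" for i
    using z(3) a1 a2 a3 a4 by (subst (asm) sum_nonneg_eq_0_iff) (auto simp: add_nonneg_nonneg)
  then have a0: "a1 i = 0" "a3 i = 0" "a4 i = 0" for i
    using a1[of i] a2[of i] a3[of i] a4[of i] by (smt (verit))+
  have Ax: "A *v x = b"
    using z(2) gains by simp
  have r: "res x \<xi> = \<xi>"
    using a0(2) gains by (simp add: vec_eq_iff a3_def)
  \<comment> \<open>With \<open>res x \<xi> = \<xi>\<close>, \<open>a4 i = 0\<close> says
    \<open>\<xi>s $ i * g x $ i = 0\<close>; then \<open>a1 i = 0\<close> removes the slope of the
    constraint.\<close>
  have "(\<Sum>i\<in>UNIV. \<xi>s $ i * (dg i xs \<bullet> (x - xs))) = 0"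
  proof (rule sum.neutral, rule ballI)
    fix i
    have "\<xi>s $ i * g x $ i = 0"
      using a0(3)[of i] gains by (auto simp: a4_def r)
    then show "\<xi>s $ i * (dg i xs \<bullet> (x - xs)) = 0"
      using a0(1)[of i] by (auto simp: a1_def)
  qed
  then have "df xs \<bullet> (x - xs) = 0"
    using KKT_gradient_inner[OF K, of "x - xs"] Ks(1) Ax by (simp add: matrix_vector_mult_diff_distrib)
  \<comment> \<open>Both \<open>df xs\<close> and \<open>df x\<close> are now orthogonal to
    \<open>x - xs\<close>, so the two tangent inequalities bound \<open>f x\<close> and
    \<open>f xs\<close> by each other.\<close>
  then have "f x = f xs"
    using f_above[of xs x] f_above[of x xs] z(1) by (simp add: inner_diff_left inner_diff_right)
  then show "A *v x = b \<and> res x \<xi> = \<xi> \<and> f x = f xs"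
    using Ax r by blast
qed

text \<open>The value does not depend on \<open>\<nu>\<close>, so it is constant on the zero set of
  the dissipation even at points where \<open>\<nu>\<close> is no multiplier.\<close>

lemma aug_lagrangian_eq_f:
  assumes "A *v x = b" "res x \<xi> = \<xi>"
  shows "aug_lagrangian (x, \<nu>, \<xi>) = f x"
proof -
  have "max (\<xi> $ i + kpi * g x $ i) 0 = \<xi> $ i" for i
    using assms(2) res_component by metis
  then show ?thesis
    using assms(1) by (simp add: aug_lagrangian_def)
qed

text \<open>Where the dissipation vanishes, the rate is \<open>- ((M *v q) \<bullet> q)\<close> with
  \<open>M *v q = grad_L x \<nu> \<xi>\<close>. Since \<open>M\<close> dominates the identity, a
  zero rate forces stationarity in \<open>x\<close>, the one KKT condition that the dissipation does
  not detect.\<close>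

lemma KKT_if_stationary:
  assumes "(xs, \<nu>s, \<xi>s) \<in> KKT_points f g A b" "dissipation (xs, \<nu>s, \<xi>s) (x, \<nu>, \<xi>) = 0" "aug_lagrangian_rate (x, \<nu>, \<xi>) = 0"
  shows "(x, \<nu>, \<xi>) \<in> KKT_points f g A b"
proof -
  have *: "A *v x = b" "res x \<xi> = \<xi>"
    using dissipation_eq_0[OF assms(1,2)] by auto
  define q where "q = matrix_inv M *v grad_L x \<nu> \<xi>"
  have "grad_L x \<nu> \<xi> \<bullet> q = 0"
    using assms(3) * by (simp add: aug_lagrangian_rate_def F_eq q_def)
  then have "(M *v q) \<bullet> q = 0"
    by (simp add: q_def M_matrix_inv)
  then have "q = 0"
    using M_inner_self[of q] inner_ge_zero[of q] by (simp add: order_antisym_conv)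
  then have "grad_L x \<nu> \<xi> = 0"
    using M_matrix_inv[of "grad_L x \<nu> \<xi>"] by (simp add: q_def)
  then show ?thesis
    using * by (simp add: KKT_points_alt)
qed

section \<open>Derivatives along solutions\<close>

lemma solution_components:
  assumes "(z has_vector_derivative F (z t)) (at t within S)"
    and "x = fst \<circ> z" "\<nu> = fst \<circ> snd \<circ> z" "\<xi> = snd \<circ> snd \<circ> z"
  shows "(x has_vector_derivative - (matrix_inv M *v grad_L (x t) (\<nu> t) (\<xi> t))) (at t within S)"
    and "(\<nu> has_vector_derivative ki *\<^sub>R (A *v x t - b)) (at t within S)"
    and "(\<xi> has_vector_derivative kii *\<^sub>R (res (x t) (\<xi> t) - \<xi> t)) (at t within S)"
proof -
  have z: "z t = (x t, \<nu> t, \<xi> t)"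
    by (simp add: assms)
  note d1 = bounded_linear.has_vector_derivative[OF bounded_linear_fst assms(1)]
  note d2 = bounded_linear.has_vector_derivative[OF bounded_linear_snd assms(1)]
  note d3 = bounded_linear.has_vector_derivative[OF bounded_linear_fst d2]
  note d4 = bounded_linear.has_vector_derivative[OF bounded_linear_snd d2]
  show "(x has_vector_derivative - (matrix_inv M *v grad_L (x t) (\<nu> t) (\<xi> t))) (at t within S)"
    using d1 unfolding z F_eq by (simp add: assms o_def)
  show "(\<nu> has_vector_derivative ki *\<^sub>R (A *v x t - b)) (at t within S)"
    using d3 unfolding z F_eq by (simp add: assms o_def)
  show "(\<xi> has_vector_derivative kii *\<^sub>R (res (x t) (\<xi> t) - \<xi> t)) (at t within S)"
    using d4 unfolding z F_eq by (simp add: assms o_def)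
qed

lemma has_vector_derivative_inner:
  "(u has_vector_derivative u') (at t within S) \<Longrightarrow> (v has_vector_derivative v') (at t within S) \<Longrightarrow>
    ((\<lambda>t. u t \<bullet> v t) has_vector_derivative (u t \<bullet> v' + u' \<bullet> v t)) (at t within S)"
  by (rule bounded_bilinear.has_vector_derivative[OF bounded_bilinear_inner])

lemma has_vector_derivative_matrix_vector_mult:
  "(u has_vector_derivative u') (at t within S) \<Longrightarrow>
    ((\<lambda>t. B *v u t) has_vector_derivative B *v u') (at t within S)" for B :: "real^'k^'l"
  by (rule bounded_linear.has_vector_derivative[OF matrix_vector_mul_bounded_linear])

lemma has_vector_derivative_gradient:
  assumes "\<And>x. GDERIV h x :> dh x" "(x has_vector_derivative x') (at t within S)"
  shows "((\<lambda>t. h (x t)) has_vector_derivative dh (x t) \<bullet> x') (at t within S)"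
proof -
  have "(h has_derivative (\<lambda>v. v \<bullet> dh (x t))) (at (x t))"
    using assms(1) by (simp add: gderiv_def)
  then have "(h has_derivative (\<lambda>v. v \<bullet> dh (x t))) (at (x t) within x ` S)"
    by (rule has_derivative_at_withinI)
  from vector_derivative_diff_chain_within[OF assms(2) this] show ?thesis
    by (simp add: o_def inner_commute)
qed

lemma lyapunov_derivative:
  assumes "(z has_vector_derivative F (z t)) (at t within S)"
  shows "((\<lambda>t. lyapunov zs (z t)) has_vector_derivative - 2 * dissipation zs (z t)) (at t within S)"
proof -
  obtain xs \<nu>s \<xi>s where zs: "zs = (xs, \<nu>s, \<xi>s)"
    by (metis prod_cases3)
  define x \<nu> \<xi> where z: "x = fst \<circ> z" "\<nu> = fst \<circ> snd \<circ> z" "\<xi> = snd \<circ> snd \<circ> z"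
  define q where "q = matrix_inv M *v grad_L (x t) (\<nu> t) (\<xi> t)"
  note d = solution_components[OF assms z, folded q_def]
  have dx: "((\<lambda>t. x t - xs) has_vector_derivative - q) (at t within S)"
    and d\<nu>: "((\<lambda>t. \<nu> t - \<nu>s) has_vector_derivative ki *\<^sub>R (A *v x t - b)) (at t within S)"
    and d\<xi>: "((\<lambda>t. \<xi> t - \<xi>s) has_vector_derivative kii *\<^sub>R (res (x t) (\<xi> t) - \<xi> t)) (at t within S)"
    using has_vector_derivative_diff[OF d(1) has_vector_derivative_const]
      has_vector_derivative_diff[OF d(2) has_vector_derivative_const]
      has_vector_derivative_diff[OF d(3) has_vector_derivative_const] by auto
  have Veq: "lyapunov zs (z t) = (M *v (x t - xs)) \<bullet> (x t - xs) + (1 / ki) *\<^sub>R ((\<nu> t - \<nu>s) \<bullet> (\<nu> t - \<nu>s))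
      + (1 / (kii * kpi)) *\<^sub>R ((\<xi> t - \<xi>s) \<bullet> (\<xi> t - \<xi>s))" for t
    unfolding lyapunov_def zs z by (simp add: case_prod_beta)
  let ?d = "(M *v (x t - xs)) \<bullet> (- q) + (M *v (- q)) \<bullet> (x t - xs)
      + (1 / ki) *\<^sub>R ((\<nu> t - \<nu>s) \<bullet> (ki *\<^sub>R (A *v x t - b)) + (ki *\<^sub>R (A *v x t - b)) \<bullet> (\<nu> t - \<nu>s))
      + (1 / (kii * kpi)) *\<^sub>R ((\<xi> t - \<xi>s) \<bullet> (kii *\<^sub>R (res (x t) (\<xi> t) - \<xi> t))
          + (kii *\<^sub>R (res (x t) (\<xi> t) - \<xi> t)) \<bullet> (\<xi> t - \<xi>s))"
  have "((\<lambda>t. lyapunov zs (z t)) has_vector_derivative ?d) (at t within S)"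
    unfolding Veq
    by (intro has_vector_derivative_add bounded_linear.has_vector_derivative[OF bounded_linear_scaleR_right]
        has_vector_derivative_inner has_vector_derivative_matrix_vector_mult dx d\<nu> d\<xi>)
  moreover have "?d = - 2 * dissipation zs (z t)"
  proof -
    \<comment> \<open>Symmetry of \<open>M\<close> makes the two halves of the product rule equal;
      \<open>M\<close> then cancels its inverse inside \<open>q\<close>.\<close>
    have "(M *v (x t - xs)) \<bullet> (- q) = (M *v (- q)) \<bullet> (x t - xs)"
      using M_inner_commute[of "x t - xs" "- q"] by (simp add: inner_commute)
    moreover have "M *v (- q) = - grad_L (x t) (\<nu> t) (\<xi> t)"
      using M_matrix_inv by (simp add: q_def linear_neg)
    moreover have "dissipation zs (z t) = grad_L (x t) (\<nu> t) (\<xi> t) \<bullet> (x t - xs) - (\<nu> t - \<nu>s) \<bullet> (A *v x t - b)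
        - (res (x t) (\<xi> t) - \<xi> t) \<bullet> (\<xi> t - \<xi>s) / kpi"
      unfolding dissipation_def zs z by (simp add: case_prod_beta)
    moreover have "(1 / ki) *\<^sub>R ((\<nu> t - \<nu>s) \<bullet> (ki *\<^sub>R (A *v x t - b)) + (ki *\<^sub>R (A *v x t - b)) \<bullet> (\<nu> t - \<nu>s))
        = 2 * ((\<nu> t - \<nu>s) \<bullet> (A *v x t - b))"
      using gains by (simp add: inner_commute[of "A *v x t - b"] add_divide_distrib)
    moreover have "(1 / (kii * kpi)) *\<^sub>R ((\<xi> t - \<xi>s) \<bullet> (kii *\<^sub>R (res (x t) (\<xi> t) - \<xi> t))
          + (kii *\<^sub>R (res (x t) (\<xi> t) - \<xi> t)) \<bullet> (\<xi> t - \<xi>s))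
        = 2 * ((res (x t) (\<xi> t) - \<xi> t) \<bullet> (\<xi> t - \<xi>s) / kpi)"
      using gains by (simp add: inner_commute[of "\<xi> t - \<xi>s"] add_divide_distrib)
    ultimately show ?thesis
      by simp
  qed
  ultimately show ?thesis
    by simp
qed

lemma aug_lagrangian_derivative:
  assumes "(z has_vector_derivative F (z t)) (at t within S)"
  shows "((\<lambda>t. aug_lagrangian (z t)) has_vector_derivative aug_lagrangian_rate (z t)) (at t within S)"
proof -
  define x \<nu> \<xi> where z: "x = fst \<circ> z" "\<nu> = fst \<circ> snd \<circ> z" "\<xi> = snd \<circ> snd \<circ> z"
  define q where "q = matrix_inv M *v grad_L (x t) (\<nu> t) (\<xi> t)"
  define h where "h t = A *v x t - b" for t
  define s where "s t = res (x t) (\<xi> t) - \<xi> t" for t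
  note d = solution_components[OF assms z, folded q_def h_def s_def]
  have dh: "(h has_vector_derivative A *v (- q)) (at t within S)"
    using has_vector_derivative_diff[OF has_vector_derivative_matrix_vector_mult[OF d(1), of A]
        has_vector_derivative_const[of b]] by (simp add: h_def[abs_def])
  have d\<xi>: "((\<lambda>t. \<xi> t $ i) has_vector_derivative kii * s t $ i) (at t within S)" for i
    using bounded_linear.has_vector_derivative[OF bounded_linear_vec_nth d(3)] by simp
  have dr: "((\<lambda>t. (max (\<xi> t $ i + kpi * g (x t) $ i) 0)\<^sup>2 - (\<xi> t $ i)\<^sup>2) has_vector_derivative
      2 * (res (x t) (\<xi> t) $ i * (kii * s t $ i + kpi * (dg i (x t) \<bullet> (- q))) - \<xi> t $ i * (kii * s t $ i)))
      (at t within S)" for i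
  proof -
    have "((\<lambda>t. \<xi> t $ i + kpi * g (x t) $ i) has_vector_derivative
        kii * s t $ i + kpi * (dg i (x t) \<bullet> (- q))) (at t within S)"
      using has_vector_derivative_add[OF d\<xi>[of i]
          bounded_linear.has_vector_derivative[OF bounded_linear_mult_right[of kpi]
            has_vector_derivative_gradient[OF GDERIV_g[of i] d(1)]]] .
    then have "((\<lambda>t. \<xi> t $ i + kpi * g (x t) $ i) has_field_derivative
        kii * s t $ i + kpi * (dg i (x t) \<bullet> (- q))) (at t within S)"
      by (simp add: has_real_derivative_iff_has_vector_derivative)
    from DERIV_chain2[OF DERIV_relu_square this]
    have "((\<lambda>t. (max (\<xi> t $ i + kpi * g (x t) $ i) 0)\<^sup>2) has_field_derivative
        2 * max (\<xi> t $ i + kpi * g (x t) $ i) 0 * (kii * s t $ i + kpi * (dg i (x t) \<bullet> (- q)))) (at t within S)" .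
    moreover have "((\<lambda>t. (\<xi> t $ i)\<^sup>2) has_field_derivative 2 * \<xi> t $ i * (kii * s t $ i)) (at t within S)"
      using d\<xi>[of i] unfolding has_real_derivative_iff_has_vector_derivative[symmetric]
      by (auto intro!: derivative_eq_intros)
    ultimately have "((\<lambda>t. (max (\<xi> t $ i + kpi * g (x t) $ i) 0)\<^sup>2 - (\<xi> t $ i)\<^sup>2) has_field_derivative
        2 * max (\<xi> t $ i + kpi * g (x t) $ i) 0 * (kii * s t $ i + kpi * (dg i (x t) \<bullet> (- q)))
        - 2 * \<xi> t $ i * (kii * s t $ i)) (at t within S)"
      by (rule DERIV_diff)
    then show ?thesis
      by (simp add: res_component has_real_derivative_iff_has_vector_derivative right_diff_distrib mult.assoc)
  qed
  have Eeq: "aug_lagrangian (z t) = f (x t) + \<nu> t \<bullet> h t + (kp / 2) *\<^sub>R (h t \<bullet> h t)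
      + (1 / (2 * kpi)) *\<^sub>R (\<Sum>i\<in>UNIV. (max (\<xi> t $ i + kpi * g (x t) $ i) 0)\<^sup>2 - (\<xi> t $ i)\<^sup>2)" for t
    unfolding aug_lagrangian_def z h_def by (simp add: case_prod_beta)
  let ?d = "df (x t) \<bullet> (- q) + (\<nu> t \<bullet> (A *v (- q)) + (ki *\<^sub>R h t) \<bullet> h t)
      + (kp / 2) *\<^sub>R (h t \<bullet> (A *v (- q)) + (A *v (- q)) \<bullet> h t)
      + (1 / (2 * kpi)) *\<^sub>R (\<Sum>i\<in>UNIV. 2 * (res (x t) (\<xi> t) $ i *
          (kii * s t $ i + kpi * (dg i (x t) \<bullet> (- q))) - \<xi> t $ i * (kii * s t $ i)))"
  have "((\<lambda>t. aug_lagrangian (z t)) has_vector_derivative ?d) (at t within S)"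
    unfolding Eeq
    by (intro has_vector_derivative_add bounded_linear.has_vector_derivative[OF bounded_linear_scaleR_right]
        has_vector_derivative_inner has_vector_derivative_sum has_vector_derivative_gradient GDERIV_f
        dh d dr)
  moreover have "?d = aug_lagrangian_rate (z t)"
  proof -
    \<comment> \<open>The terms with \<open>kii\<close> combine because \<open>res - \<xi>\<close>
      is \<open>s\<close> itself, which produces the square.\<close>
    have "(1 / (2 * kpi)) *\<^sub>R (\<Sum>i\<in>UNIV. 2 * (res (x t) (\<xi> t) $ i *
          (kii * s t $ i + kpi * (dg i (x t) \<bullet> (- q))) - \<xi> t $ i * (kii * s t $ i)))
        = (\<Sum>i\<in>UNIV. res (x t) (\<xi> t) $ i * (dg i (x t) \<bullet> (- q)) + kii / kpi * (s t $ i * s t $ i))"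
      unfolding real_scaleR_def sum_distrib_left
      by (intro sum.cong) (use gains in \<open>auto simp: s_def field_simps\<close>)
    then have "?d = grad_L (x t) (\<nu> t) (\<xi> t) \<bullet> (- q) + ki * (h t \<bullet> h t) + kii / kpi * (s t \<bullet> s t)"
      unfolding grad_L_def h_def[symmetric]
      by (simp only: inner_add_left inner_sum_left dot_lmul_matrix sum.distrib
          inner_scaleR_left sum_distrib_left[symmetric] inner_vec_def[of "s t"] inner_real_def)
        (simp add: inner_commute)
    also have "\<dots> = aug_lagrangian_rate (z t)"
      unfolding aug_lagrangian_rate_def by (simp add: case_prod_beta F_eq h_def s_def q_def z)
    finally show ?thesis .
  qed
  ultimately show ?thesis
    by simp
qed

end

section \<open>Convergence\<close>

context sppid
begin

section \<open>Boundedness and completeness\<close>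

lemma lyapunov_antimono:
  assumes z: "solution_upto F T z" and K: "zs \<in> KKT_points f g A b"
    and "0 \<le> s" "s \<le> t" "ereal t < T"
  shows "lyapunov zs (z t) \<le> lyapunov zs (z s)"
proof -
  have "((\<lambda>r. - 2 * dissipation zs (z r)) has_integral (lyapunov zs (z t) - lyapunov zs (z s))) {s..t}"
  proof (rule fundamental_theorem_of_calculus)
    fix r assume r: "r \<in> {s..t}"
    then have "ereal r < T"
      using assms(5) le_less_trans[of "ereal r" "ereal t" T] by simp
    then have "(z has_vector_derivative F (z r)) (at r within {0..})"
      using z r \<open>0 \<le> s\<close> by (simp add: solution_upto_def)
    then have "(z has_vector_derivative F (z r)) (at r within {s..t})"
      by (rule has_vector_derivative_within_subset) (use \<open>0 \<le> s\<close> in auto)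
    then show "((\<lambda>t. lyapunov zs (z t)) has_vector_derivative - 2 * dissipation zs (z r)) (at r within {s..t})"
      by (rule lyapunov_derivative)
  qed (use assms in auto)
  then have "lyapunov zs (z t) - lyapunov zs (z s) \<le> 0"
  proof (rule has_integral_le[OF _ has_integral_0])
    show "- 2 * dissipation zs (z r) \<le> 0" for r
      using dissipation_nonneg K by (cases zs; cases "z r") auto
  qed
  then show ?thesis
    by simp
qed

text \<open>The constant is fixed before the solution, so one \<open>c\<close> serves all
  trajectories, as the stability proof requires.\<close>

lemma solution_bounded:
  assumes K: "zs \<in> KKT_points f g A b"
  obtains c where "0 < c"
    "\<And>T z t. solution_upto F T z \<Longrightarrow> 0 \<le> t \<Longrightarrow> ereal t < T \<Longrightarrow> c * (norm (z t - zs))\<^sup>2 \<le> lyapunov zs (z 0)"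
proof -
  obtain c where "0 < c" and c: "\<And>zs z. c * (norm (z - zs))\<^sup>2 \<le> lyapunov zs z"
    using lyapunov_lower by blast
  have "c * (norm (z t - zs))\<^sup>2 \<le> lyapunov zs (z 0)"
    if "solution_upto F T z" "0 \<le> t" "ereal t < T" for T z t
    using lyapunov_antimono[OF that(1) K order_refl that(2,3)] c[of "z t" zs] by linarith
  then show thesis
    using that \<open>0 < c\<close> by blast
qed

lemma solution_norm_bound:
  assumes K: "zs \<in> KKT_points f g A b" and z: "solution_upto F T z"
  obtains R where "\<And>t. 0 \<le> t \<Longrightarrow> ereal t < T \<Longrightarrow> norm (z t) \<le> R"
proof -
  obtain c where "0 < c"
    and c: "\<And>t. 0 \<le> t \<Longrightarrow> ereal t < T \<Longrightarrow> c * (norm (z t - zs))\<^sup>2 \<le> lyapunov zs (z 0)"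
    using solution_bounded[OF K] z by metis
  have "norm (z t) \<le> norm zs + sqrt (lyapunov zs (z 0) / c)" if "0 \<le> t" "ereal t < T" for t
  proof -
    have "(norm (z t - zs))\<^sup>2 \<le> lyapunov zs (z 0) / c"
      using c[OF that] \<open>0 < c\<close> by (simp add: pos_le_divide_eq mult.commute)
    then have "norm (z t - zs) \<le> sqrt (lyapunov zs (z 0) / c)"
      by (rule real_le_rsqrt)
    then show ?thesis
      using norm_triangle_sub[of "z t" zs] by linarith
  qed
  then show thesis
    by (rule that)
qed

lemma trajectory_complete:
  assumes "zs \<in> KKT_points f g A b" "trajectory F T z"
  shows "T = \<infinity>"
proof -
  obtain R where "\<And>t. 0 \<le> t \<Longrightarrow> ereal t < T \<Longrightarrow> norm (z t) \<le> R"
    using solution_norm_bound[OF assms(1)] assms(2) unfolding trajectory_def by metis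
  with continuous_on_F assms(2) show ?thesis
    by (rule bounded_trajectory_complete)
qed

section \<open>Convergence to the KKT set\<close>

lemma solution_infdist_tendsto_0:
  assumes K: "zs \<in> KKT_points f g A b" and z: "solution_upto F \<infinity> z"
  shows "((\<lambda>t. infdist (z t) (KKT_points f g A b)) \<longlongrightarrow> 0) at_top"
proof -
  obtain xs \<nu>s \<xi>s where zs: "zs = (xs, \<nu>s, \<xi>s)"
    by (metis prod_cases3)
  note K' = K[unfolded zs]
  have dz: "(z has_vector_derivative F (z t)) (at t within {0..})" if "0 \<le> t" for t
    using z that by (simp add: solution_upto_def)
  obtain R where R: "\<And>t. 0 \<le> t \<Longrightarrow> norm (z t) \<le> R"
    using solution_norm_bound[OF K z] by auto
  define S where "S = cball (0 :: (real^'n) \<times> (real^'p) \<times> (real^'m)) R"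
  have S: "compact S" "\<And>t. 0 \<le> t \<Longrightarrow> z t \<in> S"
    using R by (auto simp: S_def)
  have "compact (F ` S)"
    by (intro compact_continuous_image continuous_on_F S)
  then obtain B where "0 < B" and B: "\<And>w. w \<in> S \<Longrightarrow> norm (F w) \<le> B"
    using compact_imp_bounded bounded_pos by (metis imageI)
  have lip: "norm (z t - z s) \<le> B * (t - s)" if "0 \<le> s" "s \<le> t" for s t
    using that \<open>0 < B\<close> B S(2)
    by (intro norm_diff_le_vector_derivative[where z' = "\<lambda>t. F (z t)"])
      (auto intro!: has_vector_derivative_within_subset[OF dz])
  have "B-lipschitz_on {0..} z"
    using lip \<open>0 < B\<close> unfolding lipschitz_on_def dist_norm
    by (auto, smt (verit) norm_minus_commute)
  then have uz: "uniformly_continuous_on {0..} z"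
    by (rule lipschitz_on_uniformly_continuous)
  \<comment> \<open>A Lipschitz path in a compact set makes every continuous function of the state
    uniformly continuous in time; this covers both rates to which Barbalat's lemma is
    applied.\<close>
  have uc: "uniformly_continuous_on {0..} (\<lambda>t. h (z t))" if h: "continuous_on S h"
    for h :: "(real^'n) \<times> (real^'p) \<times> (real^'m) \<Rightarrow> real"
  proof (rule uniformly_continuous_on_compose[OF uz, unfolded o_def])
    show "uniformly_continuous_on (z ` {0..}) h"
      unfolding uniformly_continuous_on_def
    proof (intro allI impI)
      fix e :: real assume "0 < e"
      then obtain d where "0 < d" "\<And>u v. u \<in> S \<Longrightarrow> v \<in> S \<Longrightarrow> dist v u < d \<Longrightarrow> dist (h v) (h u) < e"
        using compact_uniformly_continuous[OF h S(1)] unfolding uniformly_continuous_on_def by metis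
      then show "\<exists>d>0. \<forall>u\<in>z ` {0..}. \<forall>v\<in>z ` {0..}. dist v u < d \<longrightarrow> dist (h v) (h u) < e"
        using S(2) by (intro exI[of _ d]) auto
    qed
  qed
  obtain l where "((\<lambda>t. lyapunov zs (z t)) \<longlongrightarrow> l) at_top"
  proof (rule bounded_antimono_convergent_at_top[of "\<lambda>t. lyapunov zs (z t)" 0])
    show "lyapunov zs (z t) \<le> lyapunov zs (z s)" if "0 \<le> s" "s \<le> t" for s t
      using lyapunov_antimono[OF z K that] by simp
    obtain c where "0 < c" "\<And>zs z. c * (norm (z - zs))\<^sup>2 \<le> lyapunov zs z"
      using lyapunov_lower by blast
    then show "0 \<le> lyapunov zs (z t)" for t
      by (meson order_trans zero_le_mult_iff zero_le_power2 less_imp_le)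
  qed
  moreover have "uniformly_continuous_on {0..} (\<lambda>t. - 2 * dissipation zs (z t))"
    by (rule uc) (intro continuous_intros continuous_on_dissipation)
  ultimately have "((\<lambda>t. - 2 * dissipation zs (z t)) \<longlongrightarrow> 0) at_top"
    using lyapunov_derivative[OF dz] by (intro barbalat[of "\<lambda>t. lyapunov zs (z t)"]) auto
  from tendsto_mult_left[OF this, of "- 1 / 2"]
  have D0: "((\<lambda>t. dissipation zs (z t)) \<longlongrightarrow> 0) at_top"
    by simp
  have "aug_lagrangian w = f xs" if "dissipation zs w = 0" for w
    using dissipation_eq_0[OF K'] aug_lagrangian_eq_f that by (cases w) (auto simp: zs)
  then have "((\<lambda>t. aug_lagrangian (z t)) \<longlongrightarrow> f xs) at_top"
    by (intro tendsto_along_zeros[OF S(1) continuous_on_dissipation continuous_on_aug_lagrangian S(2) D0]) auto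
  then have W0: "((\<lambda>t. aug_lagrangian_rate (z t)) \<longlongrightarrow> 0) at_top"
    using aug_lagrangian_derivative[OF dz] uc[OF continuous_on_aug_lagrangian_rate] by (intro barbalat[of "\<lambda>t. aug_lagrangian (z t)"]) auto
  \<comment> \<open>The sum of absolute values vanishes only where both functions do, hence only at
    KKT points, so the compactness argument applies with the distance to the KKT set as the second
    function.\<close>
  have "((\<lambda>t. \<bar>dissipation zs (z t)\<bar> + \<bar>aug_lagrangian_rate (z t)\<bar>) \<longlongrightarrow> 0) at_top"
    using tendsto_add[OF tendsto_rabs_zero[OF D0] tendsto_rabs_zero[OF W0]] by simp
  then show ?thesis
  proof (rule tendsto_along_zeros[OF S(1), rotated 3])
    show "continuous_on S (\<lambda>w. \<bar>dissipation zs w\<bar> + \<bar>aug_lagrangian_rate w\<bar>)"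
      by (intro continuous_intros continuous_on_dissipation continuous_on_aug_lagrangian_rate)
    show "continuous_on S (\<lambda>w. infdist w (KKT_points f g A b))"
      by (intro continuous_intros)
    show "z t \<in> S" if "0 \<le> t" for t
      using that by (rule S(2))
    show "infdist w (KKT_points f g A b) = 0" if "\<bar>dissipation zs w\<bar> + \<bar>aug_lagrangian_rate w\<bar> = 0" for w
    proof -
      have "dissipation zs w = 0" "aug_lagrangian_rate w = 0"
        using that by auto
      then have "w \<in> KKT_points f g A b"
        using KKT_if_stationary[OF K'] by (cases w) (auto simp: zs)
      then show ?thesis
        by (rule infdist_zero)
    qed
  qed
qed

lemma trajectory_converges_to_KKT:
  assumes K: "zs \<in> KKT_points f g A b" and z: "trajectory F T z"
  shows "T = \<infinity> \<and> converges_to_set z (KKT_points f g A b)"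
proof -
  have "T = \<infinity>"
    using K z by (rule trajectory_complete)
  then have "solution_upto F \<infinity> z"
    using z by (simp add: trajectory_def)
  then show ?thesis
    using solution_infdist_tendsto_0[OF K] \<open>T = \<infinity>\<close> K by (auto simp: converges_to_set_def)
qed

text \<open>The Lyapunov function does not grow and dominates \<open>c\<close> times the squared
  distance, so an initial value below \<open>c * \<epsilon>\<^sup>2\<close> suffices. Its continuity
  and its value \<open>0\<close> at \<open>zs\<close> provide \<open>\<delta>\<close>.\<close>

lemma KKT_lyapunov_stable:
  assumes K: "zs \<in> KKT_points f g A b"
  shows "lyapunov_stable F zs"
  unfolding lyapunov_stable_def
proof (intro allI impI)
  fix \<epsilon> :: real assume "0 < \<epsilon>"
  obtain c where "0 < c" and c: "\<And>T z t. solution_upto F T z \<Longrightarrow> 0 \<le> t \<Longrightarrow> ereal t < T \<Longrightarrow>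
      c * (norm (z t - zs))\<^sup>2 \<le> lyapunov zs (z 0)"
    using solution_bounded[OF K] by blast
  have "isCont (lyapunov zs) zs"
    using continuous_on_lyapunov[of UNIV zs] continuous_on_eq_continuous_at[OF open_UNIV] by blast
  moreover have "0 < c * \<epsilon>\<^sup>2"
    using \<open>0 < c\<close> \<open>0 < \<epsilon>\<close> by simp
  ultimately obtain \<delta> where "0 < \<delta>"
    and \<delta>: "\<And>w. dist w zs < \<delta> \<Longrightarrow> dist (lyapunov zs w) (lyapunov zs zs) < c * \<epsilon>\<^sup>2"
    unfolding continuous_at_eps_delta by metis
  have "dist (z t) zs < \<epsilon>"
    if z: "trajectory F T z" "dist (z 0) zs < \<delta>" and t: "0 \<le> t" "ereal t < T" for T z t
  proof -
    have "c * (norm (z t - zs))\<^sup>2 \<le> lyapunov zs (z 0)"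
      using z t by (intro c) (auto simp: trajectory_def)
    also have "\<dots> < c * \<epsilon>\<^sup>2"
      using \<delta>[OF z(2)] by (simp add: lyapunov_self dist_real_def)
    finally have "(norm (z t - zs))\<^sup>2 < \<epsilon>\<^sup>2"
      using \<open>0 < c\<close> by simp
    then show ?thesis
      using \<open>0 < \<epsilon>\<close> by (simp add: dist_norm power_less_imp_less_base)
  qed
  then show "\<exists>\<delta>>0. \<forall>T z. trajectory F T z \<and> dist (z 0) zs < \<delta> \<longrightarrow>
      (\<forall>t\<ge>0. ereal t < T \<longrightarrow> dist (z t) zs < \<epsilon>)"
    using \<open>0 < \<delta>\<close> by blast
qed

lemma unique_KKT_globally_asymptotically_stable:
  assumes K: "KKT_points f g A b = {zs}"
  shows "globally_asymptotically_stable F zs"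
  unfolding globally_asymptotically_stable_def
proof (intro conjI)
  have zs: "zs \<in> KKT_points f g A b"
    by (simp add: K)
  show "F zs = 0" "lyapunov_stable F zs"
    using zs by (rule KKT_imp_F_eq_0 KKT_lyapunov_stable)+
  show "globally_attractive F zs"
    unfolding globally_attractive_def
  proof (intro allI impI)
    fix T z assume "trajectory F T z"
    then have "T = \<infinity>" "((\<lambda>t. dist (z t) zs) \<longlongrightarrow> 0) at_top"
      using trajectory_converges_to_KKT[OF zs] by (auto simp: converges_to_set_def K)
    then show "T = \<infinity> \<and> (z \<longlongrightarrow> zs) at_top"
      using tendsto_dist_iff by blast
  qed
qed

end

theorem theorem3p2:
  fixes f :: "real^'n \<Rightarrow> real"
    and g :: "real^'n \<Rightarrow> real^'m"
    and A :: "real^'n^'p"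
    and b :: "real^'p"
    and kd_eq kp_eq ki_eq kp_in ki_in :: real
  assumes "convex_on UNIV f" and "continuously_differentiable f"
    and "\<And>i. convex_on UNIV (\<lambda>x. g x $ i)"
    and "\<And>i. continuously_differentiable (\<lambda>x. g x $ i)"
    and "slater g A b"
    and "\<exists>x. optimal f g A b x"
    and "kd_eq \<ge> 0" and "kp_eq > 0" and "ki_eq > 0" and "kp_in > 0" and "ki_in > 0"
  shows "(\<forall>T z. trajectory (sppid_field f g A b kd_eq kp_eq ki_eq kp_in ki_in) T z \<longrightarrow>
            T = \<infinity> \<and> converges_to_set z (KKT_points f g A b))
       \<and> (\<forall>xs. strictly_convex f \<and> optimal f g A b xs \<and> LICQ g A xs \<longrightarrow>
            (\<exists>\<nu>s \<xi>s. KKT_points f g A b = {(xs, \<nu>s, \<xi>s)} \<and>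
               globally_asymptotically_stable
                 (sppid_field f g A b kd_eq kp_eq ki_eq kp_in ki_in) (xs, \<nu>s, \<xi>s)))"
proof -
  have "sppid f g kd_eq kp_eq ki_eq kp_in ki_in"
    by (rule sppid.intro[OF convex_program.intro[OF assms(1-4)] sppid_axioms.intro[OF assms(7-11)]])
  then interpret sppid f g A b kd_eq kp_eq ki_eq kp_in ki_in .
  obtain x where "optimal f g A b x"
    using assms(6) by blast
  \<comment> \<open>Slater's condition turns the assumed minimizer into a KKT point. It is the
    reference point of the Lyapunov function and shows that the target set is nonempty.\<close>
  then obtain zs where zs: "zs \<in> KKT_points f g A b"
    using optimal_imp_KKT assms(5) by blast
  show ?thesis
  proof (intro conjI allI impI)
    fix T z assume "trajectory F T z"
    with zs show "T = \<infinity>" "converges_to_set z (KKT_points f g A b)"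
      using trajectory_converges_to_KKT by blast+
  next
    fix xs assume "strictly_convex f \<and> optimal f g A b xs \<and> LICQ g A xs"
    then obtain \<nu>s \<xi>s where "KKT_points f g A b = {(xs, \<nu>s, \<xi>s)}"
      using unique_KKT_point[OF assms(5)] by blast
    then show "\<exists>\<nu>s \<xi>s. KKT_points f g A b = {(xs, \<nu>s, \<xi>s)} \<and>
        globally_asymptotically_stable F (xs, \<nu>s, \<xi>s)"
      using unique_KKT_globally_asymptotically_stable by blast
  qed
qed

end
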